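(* Let $L$ be a field, $\sigma\in\operatorname{Aut}(L)$ a field automorphism of finite order $n$, and $L^\sigma$ the invariant subfield. Let $\{\alpha,\sigma(\alpha),\dots,\sigma^{n-1}(\alpha)\}$ be a normal basis of $L$ over $L^\sigma$ and $\beta=\alpha^{-1}\sigma(\alpha)$. Let $\mathcal{R}=L[x;\sigma]/\langle x^n-1\rangle$, let $2\le\delta\le n$, let $g=[x-\beta,x-\sigma(\beta),\dots,x-\sigma^{\delta-2}(\beta)]_\ell$ (least common left multiple), and let $\mathcal{C}\subseteq L^n$ be the skew RS code such that $\mathfrak{v}^{-1}(\mathcal{C})=\mathcal{R}g$. Put $t=\lfloor(\delta-1)/2\rfloor$. Then the PGZ decoding algorithm (described in the context) correctly finds the error: for every $c\in\mathcal{C}$ and every $e=(e_0,\dots,e_{n-1})\in L^n$ whose number of nonzero coordinates is at most $t$, the algorithm with input $y=c+e$ returns $e$.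
   Context: **Rings and codes.** $L[x;\sigma]$ is the skew polynomial ring with multiplication rule $xa=\sigma(a)x$ for $a\in L$. Since $\sigma$ has order $n$, $x^n-1$ is central. Elements of $\mathcal{R}=L[x;\sigma]/\langle x^n-1\rangle$ are identified with skew polynomials of degree $<n$, and $\mathfrak{v}:\mathcal{R}\to L^n$ is the $L$-linear isomorphism sending $\sum_{i=0}^{n-1}f_ix^i$ to $(f_0,\dots,f_{n-1})$. The least common left multiple $[f_1,\dots,f_k]_\ell$ is the (monic) generator of the left ideal $L[x;\sigma]f_1\cap\dots\cap L[x;\sigma]f_k$. **Norms and the matrix $N$.** For $\gamma\in L$, $N_i(\gamma)=\gamma\sigma(\gamma)\cdots\sigma^{i-1}(\gamma)$, with $N_0(\gamma)=1$. $N$ is the $n\times n$ matrix with $(i,j)$ entry $N_i(\sigma^j(\beta))$, $0\le i,j\le n-1$. Rows, columns and coordinates are indexed from $0$. $\varepsilon_i$ ($0\le i\le n-1$) is the canonical vector of length $n$ with $1$ in position $i$ and $0$ elsewhere. rcef and rref denote reduced column, respectively row, echelon form. **PGZ decoding algorithm.** Input $y=(y_0,\dots,y_{n-1})\in L^n$. 1. For $0\le i\le 2t-1$ compute the syndromes $s_i=\sum_{j=0}^{n-1}y_jN_j(\sigma^i(\beta))$. If all $s_i=0$, return $0$. 2. Form the $(t+1)\times t$ matrix $S^t=\left(\sigma^{-j}(s_{i+j})\sigma^i(\alpha)\right)_{0\le i\le t,\,0\le j\le t-1}$. 3. Compute $$\operatorname{rcef}(S^t)=\left(\begin{array}{c|c}\begin{array}{c}I_\mu\\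 \hline a_0\cdots a_{\mu-1}\\ \hline H'\end{array}&0_{(t+1)\times(t-\mu)}\end{array}\right),$$ where $\mu$ is the rank of $S^t$ (so $a_0,\dots,a_{\mu-1}$ are the first $\mu$ entries of row $\mu$). 4. Put $(\rho_0,\dots,\rho_\mu)=(-a_0,\dots,-a_{\mu-1},1)$ and $\rho_N=(\rho_0,\dots,\rho_\mu,0,\dots,0)N\in L^n$. Let $\{k_1,\dots,k_\nu\}$ be the set of positions of the zero coordinates of $\rho_N$. 5. If $\mu\ne\nu$: let $M_\rho$ be the $(n-\mu)\times n$ matrix whose row $i$ ($0\le i\le n-\mu-1$) is $(0,\dots,0,\sigma^i(\rho_0),\sigma^i(\rho_1),\dots,\sigma^i(\rho_\mu),0,\dots,0)$ with $i$ leading zeros. Compute $H_\rho=\operatorname{rref}(M_\rho N)$. Let $H'$ be the matrix obtained from $H_\rho$ by removing every row that is not equal to some $\varepsilon_i$. Replace $\{k_1,\dots,k_\nu\}$ (and $\nu$) by the set of positions of the zero columns of $H'$ (and its cardinality). 6. Solve for $(x_1,\dots,x_\nu)\in L^\nu$ the linear system $$(x_1,\dots,x_\nu)\,\left(\sigma^{k_j+i}(\alpha)\right)_{1\le j\le\nu,\,0\le i\le\nu-1}=(\alpha s_0,\sigma(\alpha)s_1,\dots,\sigma^{\nu-1}(\alpha)s_{\nu-1}).$$ 7. Return the vector whose coordinate in position $k_j$ is $x_j$ for $1\le j\le\nu$, and whose other coordinates are $0$. *)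

theory Defs
  imports
    "HOL-Algebra.QuotRing"
    "Jordan_Normal_Form.Gauss_Jordan_Elimination"
    "Jordan_Normal_Form.DL_Rank"
begin

section \<open>The field extension\<close>

definition has_finite_order :: "('a \<Rightarrow> 'a) \<Rightarrow> nat \<Rightarrow> bool" where
  "has_finite_order \<sigma> n \<longleftrightarrow>
     0 < n \<and> \<sigma> ^^ n = id \<and> (\<forall>m. 0 < m \<and> m < n \<longrightarrow> \<sigma> ^^ m \<noteq> id)"

definition invariant_field :: "('a \<Rightarrow> 'a) \<Rightarrow> 'a set" where
  "invariant_field \<sigma> = {a. \<sigma> a = a}"

definition normal_basis :: "('a::field \<Rightarrow> 'a) \<Rightarrow> nat \<Rightarrow> 'a \<Rightarrow> bool" where
  "normal_basis \<sigma> n \<alpha> \<longleftrightarrow>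
     (\<forall>c. (\<forall>i<n. c i \<in> invariant_field \<sigma>) \<and> (\<Sum>i<n. c i * (\<sigma> ^^ i) \<alpha>) = 0
          \<longrightarrow> (\<forall>i<n. c i = 0)) \<and>
     (\<forall>a. \<exists>c. (\<forall>i<n. c i \<in> invariant_field \<sigma>) \<and> a = (\<Sum>i<n. c i * (\<sigma> ^^ i) \<alpha>))"

section \<open>Skew polynomials and skew Reed-Solomon codes\<close>

text \<open>A skew polynomial is represented by its left coefficients, that is, \<^term>\<open>p :: 'a poly\<close>
  stands for $\sum_i p_i x^i$. Only the additive structure and the degree of
  \<^typ>\<open>'a poly\<close> are used; the product is determined by
  $(a x^i)(b x^j) = a \sigma^i(b) x^{i+j}$.\<close>

definition skew_mult :: "('a::field \<Rightarrow> 'a) \<Rightarrow> 'a poly \<Rightarrow> 'a poly \<Rightarrow> 'a poly" where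
  "skew_mult \<sigma> f g =
     (\<Sum>i\<le>degree f. \<Sum>j\<le>degree g. monom (coeff f i * (\<sigma> ^^ i) (coeff g j)) (i + j))"

definition skew_poly_ring :: "('a::field \<Rightarrow> 'a) \<Rightarrow> 'a poly ring" where
  "skew_poly_ring \<sigma> = \<lparr>carrier = UNIV, mult = skew_mult \<sigma>, one = 1, zero = 0, add = (+)\<rparr>"

definition left_principal_ideal :: "('r, 'm) ring_scheme \<Rightarrow> 'r \<Rightarrow> 'r set" where
  "left_principal_ideal R f = (\<lambda>h. h \<otimes>\<^bsub>R\<^esub> f) ` carrier R"

definition is_lclm :: "('a::field \<Rightarrow> 'a) \<Rightarrow> 'a poly set \<Rightarrow> 'a poly \<Rightarrow> bool" where
  "is_lclm \<sigma> F g \<longleftrightarrow>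
     lead_coeff g = 1 \<and>
     left_principal_ideal (skew_poly_ring \<sigma>) g =
       (\<Inter>f\<in>F. left_principal_ideal (skew_poly_ring \<sigma>) f)"

definition modulus_ideal :: "('a::field \<Rightarrow> 'a) \<Rightarrow> nat \<Rightarrow> 'a poly set" where
  "modulus_ideal \<sigma> n = genideal (skew_poly_ring \<sigma>) {monom 1 n - 1}"

definition skew_quotient_ring :: "('a::field \<Rightarrow> 'a) \<Rightarrow> nat \<Rightarrow> 'a poly set ring" where
  "skew_quotient_ring \<sigma> n = skew_poly_ring \<sigma> Quot modulus_ideal \<sigma> n"

definition residue_class :: "('a::field \<Rightarrow> 'a) \<Rightarrow> nat \<Rightarrow> 'a poly \<Rightarrow> 'a poly set" where
  "residue_class \<sigma> n f = modulus_ideal \<sigma> n +>\<^bsub>skew_poly_ring \<sigma>\<^esub> f"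

text \<open>The inverse of the left linear coordinate isomorphism from the quotient ring to $L^n$.\<close>

definition vec_to_class :: "('a::field \<Rightarrow> 'a) \<Rightarrow> nat \<Rightarrow> 'a vec \<Rightarrow> 'a poly set" where
  "vec_to_class \<sigma> n c = residue_class \<sigma> n (\<Sum>i<n. monom (c $ i) i)"

text \<open>The next lemmas show that \<^const>\<open>skew_poly_ring\<close> is a ring, so that the locale-based
  notions of two-sided ideal and quotient ring apply to it.\<close>

lemma funpow_field_hom:
  assumes "field_hom (\<sigma> :: 'a::field \<Rightarrow> 'a)"
  shows "field_hom (\<sigma> ^^ i)"
proof -
  interpret s: field_hom \<sigma> by fact
  show ?thesis
    by (unfold_locales; induction i; simp add: s.hom_add s.hom_mult)
qed

lemma coeff_skew_mult:
  fixes \<sigma> :: "'a::field \<Rightarrow> 'a"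
  assumes "field_hom \<sigma>"
  shows "coeff (skew_mult \<sigma> f g) k = (\<Sum>i=0..k. coeff f i * (\<sigma> ^^ i) (coeff g (k - i)))"
proof -
  have z [simp]: "(\<sigma> ^^ i) 0 = 0" for i
  proof -
    interpret s: field_hom "\<sigma> ^^ i" by (rule funpow_field_hom[OF assms])
    show ?thesis by simp
  qed
  have inner: "(\<Sum>j\<le>degree g. if i + j = k then coeff f i * (\<sigma> ^^ i) (coeff g j) else 0) =
      (if i \<le> k then coeff f i * (\<sigma> ^^ i) (coeff g (k - i)) else 0)" for i
  proof (cases "i \<le> k")
    case True
    have "(\<Sum>j\<le>degree g. if i + j = k then coeff f i * (\<sigma> ^^ i) (coeff g j) else 0) =
        (\<Sum>j\<le>degree g. if j = k - i then coeff f i * (\<sigma> ^^ i) (coeff g j) else 0)"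
      by (rule sum.cong) (use True in auto)
    also have "\<dots> = coeff f i * (\<sigma> ^^ i) (coeff g (k - i))"
      by (auto simp: sum.delta coeff_eq_0)
    finally show ?thesis using True by simp
  qed (auto intro!: sum.neutral)
  have "coeff (skew_mult \<sigma> f g) k =
      (\<Sum>i\<le>degree f. if i \<le> k then coeff f i * (\<sigma> ^^ i) (coeff g (k - i)) else 0)"
    by (simp add: skew_mult_def coeff_sum inner)
  also have "\<dots> = (\<Sum>i\<in>{..degree f} \<inter> {0..k}. coeff f i * (\<sigma> ^^ i) (coeff g (k - i)))"
    by (subst sum.inter_restrict) auto
  also have "\<dots> = (\<Sum>i=0..k. coeff f i * (\<sigma> ^^ i) (coeff g (k - i)))"
    by (rule sum.mono_neutral_left) (auto simp: coeff_eq_0)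
  finally show ?thesis .
qed

lemma ring_skew_poly_ring:
  fixes \<sigma> :: "'a::field \<Rightarrow> 'a"
  assumes "field_hom \<sigma>"
  shows "ring (skew_poly_ring \<sigma>)"
proof -
  note c = coeff_skew_mult[OF assms]
  have hom: "(\<sigma> ^^ i) (a + b) = (\<sigma> ^^ i) a + (\<sigma> ^^ i) b"
    "(\<sigma> ^^ i) (a * b) = (\<sigma> ^^ i) a * (\<sigma> ^^ i) b"
    "(\<sigma> ^^ i) 1 = 1"
    "(\<sigma> ^^ i) (sum h A) = (\<Sum>x\<in>A. (\<sigma> ^^ i) (h x))"
    for i a b and h :: "nat \<Rightarrow> 'a" and A
  proof -
    interpret s: field_hom "\<sigma> ^^ i" by (rule funpow_field_hom[OF assms])
    show "(\<sigma> ^^ i) (a + b) = (\<sigma> ^^ i) a + (\<sigma> ^^ i) b"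
      "(\<sigma> ^^ i) (a * b) = (\<sigma> ^^ i) a * (\<sigma> ^^ i) b"
      "(\<sigma> ^^ i) 1 = 1"
      "(\<sigma> ^^ i) (sum h A) = (\<Sum>x\<in>A. (\<sigma> ^^ i) (h x))"
      by (simp_all add: s.hom_add s.hom_mult s.hom_sum)
  qed
  have reindex: "(\<Sum>j=0..k. \<Sum>i=0..j. F i (j - i) (k - j)) =
      (\<Sum>j=0..k. \<Sum>i=0..k - j. F j i (k - j - i))"
    for k and F :: "nat \<Rightarrow> nat \<Rightarrow> nat \<Rightarrow> 'a"
    unfolding sum.Sigma[OF finite_atLeastAtMost ballI[OF finite_atLeastAtMost]]
    by (rule sum.reindex_bij_witness[where
          i = "\<lambda>(j, i). (j + i, j)" and j = "\<lambda>(j, i). (i, j - i)"]) auto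
  have assoc: "skew_mult \<sigma> (skew_mult \<sigma> f g) h = skew_mult \<sigma> f (skew_mult \<sigma> g h)" for f g h
  proof (rule poly_eqI)
    fix k
    have "coeff (skew_mult \<sigma> (skew_mult \<sigma> f g) h) k =
        (\<Sum>j=0..k. \<Sum>i=0..j. coeff f i * (\<sigma> ^^ i) (coeff g (j - i)) *
           (\<sigma> ^^ (i + (j - i))) (coeff h (k - j)))"
      by (simp add: c sum_distrib_right)
    also have "\<dots> = (\<Sum>j=0..k. \<Sum>i=0..k - j. coeff f j * (\<sigma> ^^ j) (coeff g i) *
           (\<sigma> ^^ (j + i)) (coeff h (k - j - i)))"
      by (rule reindex[where F = "\<lambda>a b d. coeff f a * (\<sigma> ^^ a) (coeff g b) *
           (\<sigma> ^^ (a + b)) (coeff h d)"])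
    also have "\<dots> = coeff (skew_mult \<sigma> f (skew_mult \<sigma> g h)) k"
      by (simp add: c hom sum_distrib_left funpow_add mult.assoc)
    finally show "coeff (skew_mult \<sigma> (skew_mult \<sigma> f g) h) k =
      coeff (skew_mult \<sigma> f (skew_mult \<sigma> g h)) k" .
  qed
  have one: "skew_mult \<sigma> 1 f = f" "skew_mult \<sigma> f 1 = f" for f
    by (simp_all add: skew_mult_def hom poly_as_sum_of_monoms)
  have distrib: "skew_mult \<sigma> (f + g) h = skew_mult \<sigma> f h + skew_mult \<sigma> g h"
    "skew_mult \<sigma> h (f + g) = skew_mult \<sigma> h f + skew_mult \<sigma> h g" for f g h
    by (simp_all add: poly_eq_iff c hom algebra_simps sum.distrib)
  show ?thesis
  proof (rule ringI)
    show "abelian_group (skew_poly_ring \<sigma>)"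
    proof (rule abelian_groupI)
      fix f assume "f \<in> carrier (skew_poly_ring \<sigma>)"
      show "\<exists>g\<in>carrier (skew_poly_ring \<sigma>). g \<oplus>\<^bsub>skew_poly_ring \<sigma>\<^esub> f = \<zero>\<^bsub>skew_poly_ring \<sigma>\<^esub>"
        by (intro bexI[of _ "- f"]) (simp_all add: skew_poly_ring_def)
    qed (simp_all add: skew_poly_ring_def add_ac)
    show "monoid (skew_poly_ring \<sigma>)"
      by (rule monoidI) (simp_all add: skew_poly_ring_def assoc one)
  qed (simp_all add: skew_poly_ring_def distrib)
qed

section \<open>The Peterson-Gorenstein-Zierler algorithm\<close>

text \<open>All rows, columns and coordinates are indexed from 0.\<close>

definition skew_norm :: "('a::field \<Rightarrow> 'a) \<Rightarrow> nat \<Rightarrow> 'a \<Rightarrow> 'a" where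
  "skew_norm \<sigma> i \<gamma> = (\<Prod>k<i. (\<sigma> ^^ k) \<gamma>)"

definition norm_matrix :: "('a::field \<Rightarrow> 'a) \<Rightarrow> nat \<Rightarrow> 'a \<Rightarrow> 'a mat" where
  "norm_matrix \<sigma> n \<beta> = mat n n (\<lambda>(i, j). skew_norm \<sigma> i ((\<sigma> ^^ j) \<beta>))"

text \<open>The library's \<^const>\<open>row_echelon_form\<close>, which \<^const>\<open>gauss_jordan_single\<close> computes, is
  the reduced one: pivots are 1 and are the only nonzero entries of their columns.\<close>

definition rref :: "'a::field mat \<Rightarrow> 'a mat" where
  "rref A = gauss_jordan_single A"

definition rcef :: "'a::field mat \<Rightarrow> 'a mat" where
  "rcef A = (rref (A\<^sup>T))\<^sup>T"

definition vec_mult_mat :: "'a::field vec \<Rightarrow> 'a mat \<Rightarrow> 'a vec" where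
  "vec_mult_mat v A = A\<^sup>T *\<^sub>v v"

definition syndrome :: "('a::field \<Rightarrow> 'a) \<Rightarrow> nat \<Rightarrow> 'a \<Rightarrow> 'a vec \<Rightarrow> nat \<Rightarrow> 'a" where
  "syndrome \<sigma> n \<beta> y i = (\<Sum>j<n. y $ j * skew_norm \<sigma> j ((\<sigma> ^^ i) \<beta>))"

definition syndrome_matrix :: "('a::field \<Rightarrow> 'a) \<Rightarrow> 'a \<Rightarrow> nat \<Rightarrow> (nat \<Rightarrow> 'a) \<Rightarrow> 'a mat" where
  "syndrome_matrix \<sigma> \<alpha> t s =
     mat (t + 1) t (\<lambda>(i, j). (inv_into UNIV \<sigma> ^^ j) (s (i + j)) * (\<sigma> ^^ i) \<alpha>)"

text \<open>The block shape of the reduced column echelon form displayed in the algorithm.\<close>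

definition has_rcef_shape :: "'a::field mat \<Rightarrow> nat \<Rightarrow> nat \<Rightarrow> bool" where
  "has_rcef_shape E t \<mu> \<longleftrightarrow>
     \<mu> \<le> t \<and>
     (\<forall>i<\<mu>. \<forall>j<\<mu>. E $$ (i, j) = (if i = j then 1 else 0)) \<and>
     (\<forall>i<t + 1. \<forall>j. \<mu> \<le> j \<and> j < t \<longrightarrow> E $$ (i, j) = 0)"

definition rho_vec :: "nat \<Rightarrow> 'a::field mat \<Rightarrow> nat \<Rightarrow> 'a vec" where
  "rho_vec n E \<mu> =
     vec n (\<lambda>i. if i < \<mu> then - E $$ (\<mu>, i) else if i = \<mu> then 1 else 0)"

definition zero_positions :: "'a::field vec \<Rightarrow> nat set" where
  "zero_positions v = {k. k < dim_vec v \<and> v $ k = 0}"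

definition rho_matrix :: "('a::field \<Rightarrow> 'a) \<Rightarrow> nat \<Rightarrow> nat \<Rightarrow> 'a vec \<Rightarrow> 'a mat" where
  "rho_matrix \<sigma> n \<mu> \<rho> =
     mat (n - \<mu>) n (\<lambda>(i, j). if i \<le> j \<and> j \<le> i + \<mu> then (\<sigma> ^^ i) (\<rho> $ (j - i)) else 0)"

definition keep_unit_rows :: "'a::field mat \<Rightarrow> 'a mat" where
  "keep_unit_rows H =
     mat_of_rows (dim_col H)
       (filter (\<lambda>r. \<exists>i<dim_col H. r = unit_vec (dim_col H) i) (rows H))"

definition zero_columns :: "'a::field mat \<Rightarrow> nat set" where
  "zero_columns H = {j. j < dim_col H \<and> col H j = 0\<^sub>v (dim_row H)}"

definition error_positions ::
    "('a::field \<Rightarrow> 'a) \<Rightarrow> nat \<Rightarrow> 'a \<Rightarrow> 'a mat \<Rightarrow> nat \<Rightarrow> nat set" where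
  "error_positions \<sigma> n \<beta> E \<mu> =
     (let N = norm_matrix \<sigma> n \<beta>;
          \<rho> = rho_vec n E \<mu>;
          K = zero_positions (vec_mult_mat \<rho> N)
      in if \<mu> = card K then K
         else zero_columns (keep_unit_rows (rref (rho_matrix \<sigma> n \<mu> \<rho> * N))))"

definition solves_value_system ::
    "('a::field \<Rightarrow> 'a) \<Rightarrow> 'a \<Rightarrow> (nat \<Rightarrow> 'a) \<Rightarrow> nat list \<Rightarrow> 'a vec \<Rightarrow> bool" where
  "solves_value_system \<sigma> \<alpha> s ks x \<longleftrightarrow>
     (let \<nu> = length ks in
      x \<in> carrier_vec \<nu> \<and>
      vec_mult_mat x (mat \<nu> \<nu> (\<lambda>(j, i). (\<sigma> ^^ (ks ! j + i)) \<alpha>)) =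
        vec \<nu> (\<lambda>i. (\<sigma> ^^ i) \<alpha> * s i))"

definition place_values :: "nat \<Rightarrow> nat list \<Rightarrow> 'a::field vec \<Rightarrow> 'a vec" where
  "place_values n ks x = vec n (\<lambda>k. \<Sum>j | j < length ks \<and> ks ! j = k. x $ j)"

text \<open>The result \<^const>\<open>None\<close> means that a step cannot be carried out as described: the
  reduced column echelon form lacks the required shape, or the linear system for the error
  values is not uniquely solvable.\<close>

definition pgz :: "('a::field \<Rightarrow> 'a) \<Rightarrow> nat \<Rightarrow> 'a \<Rightarrow> nat \<Rightarrow> 'a vec \<Rightarrow> 'a vec option" where
  "pgz \<sigma> n \<alpha> t y =
     (let \<beta> = inverse \<alpha> * \<sigma> \<alpha>;
          s = syndrome \<sigma> n \<beta> y
      in if \<forall>i<2 * t. s i = 0 then Some (0\<^sub>v n)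
         else let S = syndrome_matrix \<sigma> \<alpha> t s;
                  \<mu> = vec_space.rank (t + 1) S;
                  E = rcef S
              in if \<not> has_rcef_shape E t \<mu> then None
                 else let ks = sorted_list_of_set (error_positions \<sigma> n \<beta> E \<mu>)
                      in if \<exists>!x. solves_value_system \<sigma> \<alpha> s ks x
                         then Some (place_values n ks (THE x. solves_value_system \<sigma> \<alpha> s ks x))
                         else None)"

definition hamming_weight :: "'a::zero vec \<Rightarrow> nat" where
  "hamming_weight e = card {i. i < dim_vec e \<and> e $ i \<noteq> 0}"

end

theory Submission
  imports Defs
begin

text \<open>
  Write $a_k = \sigma^k(\alpha)$ and $E_j = (\sigma^{-j}(e_k))_k$. Since
  $N_i(\sigma^j(\beta)) = a_{i+j}/a_j$, codewords do not contribute to the syndromes, and the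
  syndrome matrix has the entries $S_{ij} = \sum_k a_{i+k} E_{jk}$. Its extension to all
  $i, j \ge 0$ has semilinear recurrences between consecutive rows and between consecutive
  columns, so its rank $\mu$ is attained by the leading $\mu \times \mu$ minor; this gives the
  shape of the column echelon form.

  The polynomial $\rho$ read off from it is a left annihilator of $S$, that is, the values
  $\rho(a_k)$ are orthogonal to all $E_j$, and so are their images under $\sigma^i$. For
  $i < n - \mu$ these images are linearly independent and therefore span the whole annihilator of
  $E_0, \dots, E_{\mu-1}$. All $E_j$ have the support of $e$, so a unit vector lies in this row
  space if and only if its position is error-free, and the unit vectors in a row space are rows of
  the reduced row echelon form. The error values then solve a Moore system, which is nonsingular.
\<close>

section \<open>Linear algebra\<close>

text \<open>The system is padded with zero rows to a square one; row \<open>m\<close> is then zero,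
  so the determinant vanishes and the kernel is nontrivial.\<close>

lemma underdetermined_system:
  fixes A :: "nat \<Rightarrow> nat \<Rightarrow> 'a::field"
  assumes "m < k"
  obtains x j where "j < k" "x j \<noteq> 0" "\<And>i. i < m \<Longrightarrow> (\<Sum>j<k. A i j * x j) = 0"
proof -
  define M where "M = mat k k (\<lambda>(i, j). if i < m then A i j else 0)"
  have M: "M \<in> carrier_mat k k" by (simp add: M_def)
  have "M\<^sup>T *\<^sub>v unit_vec k m = 0\<^sub>v k"
    using assms by (intro eq_vecI) (auto simp: M_def scalar_prod_right_unit)
  moreover have "unit_vec k m \<noteq> (0\<^sub>v k :: 'a vec)"
    using assms by (metis index_unit_vec(1) index_zero_vec(1) zero_neq_one)
  ultimately have "det M\<^sup>T = 0"
    by (subst det_0_iff_vec_prod_zero_field[of _ k])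
      (auto intro!: exI[of _ "unit_vec k m"] simp: M)
  then have "det M = 0" using det_transpose[OF M] by simp
  then obtain v where v: "v \<in> carrier_vec k" "v \<noteq> 0\<^sub>v k" "M *\<^sub>v v = 0\<^sub>v k"
    using det_0_iff_vec_prod_zero_field[OF M] by blast
  obtain j where j: "j < k" "v $ j \<noteq> 0"
    using v(1,2) by (metis carrier_vecD eq_vecI index_zero_vec)
  have "(\<Sum>j<k. A i j * v $ j) = 0" if "i < m" for i
  proof -
    have "(M *\<^sub>v v) $ i = 0" using v(3) that assms by simp
    then show ?thesis
      using that assms v(1) by (simp add: M_def scalar_prod_def lessThan_atLeast0 cong: sum.cong_simp)
  qed
  then show thesis using that j by blast
qed

text \<open>A trivial left kernel makes the determinant nonzero, and \<open>W\<close> holds the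
  entries of the inverse. Functions in place of matrices let the lemma apply directly to a corner of
  an infinite array.\<close>

lemma nonsingular_from_left_kernel:
  fixes M :: "nat \<Rightarrow> nat \<Rightarrow> 'a::field"
  assumes ker: "\<And>x. (\<And>j. j < m \<Longrightarrow> (\<Sum>i<m. x i * M i j) = 0) \<Longrightarrow> \<forall>i<m. x i = 0"
  obtains W where
    "\<And>i j. i < m \<Longrightarrow> j < m \<Longrightarrow> (\<Sum>l<m. M i l * W l j) = (if i = j then 1 else 0)"
    "\<And>i j. i < m \<Longrightarrow> j < m \<Longrightarrow> (\<Sum>l<m. W i l * M l j) = (if i = j then 1 else 0)"
proof -
  define A where "A = mat m m (\<lambda>(i, j). M i j)"
  have A: "A \<in> carrier_mat m m" by (simp add: A_def)
  have "det A\<^sup>T \<noteq> 0"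
  proof
    assume "det A\<^sup>T = 0"
    then obtain v where v: "v \<in> carrier_vec m" "v \<noteq> 0\<^sub>v m" "A\<^sup>T *\<^sub>v v = 0\<^sub>v m"
      using det_0_iff_vec_prod_zero_field[of "A\<^sup>T" m] A by auto
    have "(\<Sum>i<m. v $ i * M i j) = 0" if "j < m" for j
    proof -
      have "(A\<^sup>T *\<^sub>v v) $ j = 0" using v(3) that by simp
      then show ?thesis
        using that v(1)
        by (simp add: A_def scalar_prod_def lessThan_atLeast0 mult.commute[of "v $ _"] cong: sum.cong_simp)
    qed
    then have "\<forall>i<m. v $ i = 0" by (rule ker)
    then show False using v(1,2) by (metis carrier_vecD eq_vecI index_zero_vec)
  qed
  then have "det A \<noteq> 0" using det_transpose[OF A] by simp
  then have "A \<in> Units (ring_mat TYPE('a) m ())" by (rule det_non_zero_imp_unit[OF A])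
  then obtain B where B: "B \<in> carrier_mat m m" "B * A = 1\<^sub>m m" "A * B = 1\<^sub>m m"
    by (auto simp: Units_def ring_mat_def)
  show thesis
  proof (rule that[of "\<lambda>i j. B $$ (i, j)"])
    fix i j assume ij: "i < m" "j < m"
    have "(A * B) $$ (i, j) = 1\<^sub>m m $$ (i, j)" "(B * A) $$ (i, j) = 1\<^sub>m m $$ (i, j)"
      using B by simp_all
    then show "(\<Sum>l<m. M i l * B $$ (l, j)) = (if i = j then 1 else 0)"
      "(\<Sum>l<m. B $$ (i, l) * M l j) = (if i = j then 1 else 0)"
      using ij A B(1)
      by (simp_all add: A_def scalar_prod_def lessThan_atLeast0 cong: sum.cong_simp)
  qed
qed

section \<open>Linear combinations, recurrences and annihilators\<close>

text \<open>Vectors are functions on an arbitrary index type, so that the infinite rows and columns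
  of \<open>S\<close> qualify. The instance \<open>in_comb v d (v d)\<close> says that
  \<open>v d\<close> depends on its predecessors.\<close>

definition in_comb :: "(nat \<Rightarrow> 'b \<Rightarrow> 'a::field) \<Rightarrow> nat \<Rightarrow> ('b \<Rightarrow> 'a) \<Rightarrow> bool" where
  "in_comb v d u \<longleftrightarrow> (\<exists>x. u = (\<lambda>b. \<Sum>l<d. x l * v l b))"

lemma in_comb_member: "l < d \<Longrightarrow> in_comb v d (v l)"
  unfolding in_comb_def
  by (rule exI[of _ "\<lambda>q. if q = l then 1 else 0"]) (auto simp: if_distrib[of "\<lambda>c. c * _"] cong: if_cong)

lemma in_comb_sum:
  assumes "\<And>l. l < p \<Longrightarrow> in_comb v d (u l)"
  shows "in_comb v d (\<lambda>b. \<Sum>l<p. x l * u l b)"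
proof -
  have "\<forall>l. \<exists>y. l < p \<longrightarrow> u l = (\<lambda>b. \<Sum>q<d. y q * v q b)"
    using assms unfolding in_comb_def by auto
  then obtain y where y: "\<And>l. l < p \<Longrightarrow> u l = (\<lambda>b. \<Sum>q<d. y l q * v q b)"
    by metis
  have "(\<lambda>b. \<Sum>l<p. x l * u l b) = (\<lambda>b. \<Sum>q<d. (\<Sum>l<p. x l * y l q) * v q b)"
  proof
    fix b
    have "(\<Sum>l<p. x l * u l b) = (\<Sum>l<p. \<Sum>q<d. x l * y l q * v q b)"
      by (rule sum.cong) (simp_all add: y sum_distrib_left mult.assoc)
    also have "\<dots> = (\<Sum>q<d. \<Sum>l<p. x l * y l q * v q b)" by (rule sum.swap)
    finally show "(\<Sum>l<p. x l * u l b) = (\<Sum>q<d. (\<Sum>l<p. x l * y l q) * v q b)"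
      by (simp add: sum_distrib_right)
  qed
  then show ?thesis
    unfolding in_comb_def by (rule exI[of _ "\<lambda>q. \<Sum>l<p. x l * y l q"])
qed

text \<open>The relation is solved for its last vector with nonzero coefficient; that index is
  \<open>d\<close>.\<close>

lemma relation_imp_in_comb:
  assumes "\<And>b. (\<Sum>l<k. x l * v l b) = 0" "j < k" "x j \<noteq> 0"
  obtains d where "d < k" "in_comb v d (v d)"
  using assms
proof (induction k arbitrary: thesis)
  case (Suc k)
  show thesis
  proof (cases "x k = 0")
    case True
    then show thesis
      using Suc.prems by (intro Suc.IH[OF Suc.prems(1)]) (auto simp: less_Suc_eq)
  next
    case False
    have "v k = (\<lambda>b. \<Sum>l<k. (- x l / x k) * v l b)"
    proof
      fix b
      have "x k * v k b = - (\<Sum>l<k. x l * v l b)"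
        using Suc.prems(2)[of b] by (simp add: eq_neg_iff_add_eq_0 add.commute)
      then have "v k b = - (\<Sum>l<k. x l * v l b) / x k"
        using False by (metis nonzero_mult_div_cancel_left)
      then show "v k b = (\<Sum>l<k. (- x l / x k) * v l b)"
        by (simp add: sum_divide_distrib sum_negf)
    qed
    then show thesis
      by (intro Suc.prems(1)[of k] in_comb_def[THEN iffD2] exI[of _ "\<lambda>l. - x l / x k"]) simp_all
  qed
qed simp

text \<open>A relation of length \<open>d\<close> in a sequence generated by a semilinear map propagates to the
  whole sequence.\<close>

lemma krylov_in_comb:
  assumes semilinear: "\<And>d x. \<Phi> (\<lambda>b. \<Sum>l<d. x l * v l b) = (\<lambda>b. \<Sum>l<d. h (x l) * \<Phi> (v l) b)"
    and step: "\<And>i. v (Suc i) = \<Phi> (v i)"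
    and start: "in_comb v d (v d)"
  shows "in_comb v d (v i)"
proof (induction i)
  case 0
  then show ?case using start in_comb_member[of 0 d v] by (cases "d = 0") auto
next
  case (Suc i)
  then obtain x where "v i = (\<lambda>b. \<Sum>l<d. x l * v l b)" unfolding in_comb_def by blast
  then have "v (Suc i) = (\<lambda>b. \<Sum>l<d. h (x l) * v (Suc l) b)"
    by (simp add: step semilinear)
  \<comment> \<open>Only \<open>l = d - 1\<close> leaves the range of generators, and there
    \<open>start\<close> applies.\<close>
  moreover have "in_comb v d (v (Suc l))" if "l < d" for l
    using that start in_comb_member[of "Suc l" d v] by (cases "Suc l = d") auto
  ultimately show ?case using in_comb_sum[of d v d "\<lambda>l. v (Suc l)"] by simp
qed

text \<open>Dimension count: the pairing of the \<open>C i\<close> with the \<open>B j\<close> is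
  nonsingular, so the \<open>B j\<close> are independent and their annihilator has dimension
  \<open>n - m\<close>, which the independent \<open>A i\<close> fill.\<close>

lemma annihilator_span:
  fixes A B C :: "nat \<Rightarrow> nat \<Rightarrow> 'a::field"
  assumes mn: "m \<le> n"
    and A: "\<And>w. (\<And>k. k < n \<Longrightarrow> (\<Sum>i<n - m. w i * A i k) = 0) \<Longrightarrow> \<forall>i<n - m. w i = 0"
    and AB: "\<And>i j. i < n - m \<Longrightarrow> j < m \<Longrightarrow> (\<Sum>k<n. A i k * B j k) = 0"
    and CB: "\<And>x. (\<And>j. j < m \<Longrightarrow> (\<Sum>i<m. x i * (\<Sum>k<n. C i k * B j k)) = 0) \<Longrightarrow> \<forall>i<m. x i = 0"
    and vB: "\<And>j. j < m \<Longrightarrow> (\<Sum>k<n. v k * B j k) = 0"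
  obtains w where "\<And>k. k < n \<Longrightarrow> v k = (\<Sum>i<n - m. w i * A i k)"
proof -
  \<comment> \<open>The \<open>n + 1\<close> vectors \<open>A\<close>, \<open>C\<close>,
    \<open>v\<close> in \<open>n\<close>-space, in this order, are the columns of \<open>r\<close>;
    a kernel vector \<open>x\<close> is a linear relation among them.\<close>
  define r where "r k i = (if i < n - m then A i k else if i < n then C (i - (n - m)) k else v k)"
    for k i
  obtain x j where x: "j < Suc n" "x j \<noteq> 0" "\<And>k. k < n \<Longrightarrow> (\<Sum>i<Suc n. r k i * x i) = 0"
    by (rule underdetermined_system[of n "Suc n" r, OF lessI], rule that)
  define y where "y i = x (n - m + i)" for i
  have split: "(\<Sum>i<n - m. x i * A i k) + (\<Sum>i<m. y i * C i k) + x n * v k = 0" if "k < n" for k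
  proof -
    have "{..<n} = {..<n - m} \<union> {n - m..<n}" using mn by auto
    then have "(\<Sum>i<n. r k i * x i) = (\<Sum>i<n - m. r k i * x i) + (\<Sum>i=n - m..<n. r k i * x i)"
      by (simp add: sum.union_disjoint ivl_disj_int)
    also have "(\<Sum>i<n - m. r k i * x i) = (\<Sum>i<n - m. x i * A i k)"
      by (rule sum.cong) (simp_all add: r_def)
    also have "(\<Sum>i=n - m..<n. r k i * x i) = (\<Sum>i<m. r k (n - m + i) * x (n - m + i))"
      by (rule sum.reindex_bij_witness[of _ "\<lambda>i. n - m + i" "\<lambda>i. i - (n - m)"]) (use mn in auto)
    also have "\<dots> = (\<Sum>i<m. y i * C i k)"
      by (rule sum.cong) (use mn in \<open>auto simp: r_def y_def\<close>)
    finally have "(\<Sum>i<n. r k i * x i) = (\<Sum>i<n - m. x i * A i k) + (\<Sum>i<m. y i * C i k)" .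
    moreover have "r k n = v k" by (auto simp: r_def)
    ultimately show ?thesis
      using x(3)[OF that] by (simp add: mult.commute[of "v k"])
  qed
  \<comment> \<open>Pairing the relation with \<open>B j\<close> removes the \<open>A\<close> and
    \<open>v\<close> parts, so nonsingularity of the pairing kills the coefficients of
    \<open>C\<close>.\<close>
  have "\<forall>i<m. y i = 0"
  proof (rule CB)
    fix j assume j: "j < m"
    have "0 = (\<Sum>k<n. ((\<Sum>i<n - m. x i * A i k) + (\<Sum>i<m. y i * C i k) + x n * v k) * B j k)"
      by (simp add: split)
    also have "\<dots> = (\<Sum>k<n. \<Sum>i<n - m. x i * (A i k * B j k)) + (\<Sum>k<n. \<Sum>i<m. y i * (C i k * B j k))
        + (\<Sum>k<n. x n * (v k * B j k))"
      by (simp add: algebra_simps sum.distrib sum_distrib_left sum_distrib_right)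
    also have "(\<Sum>k<n. \<Sum>i<n - m. x i * (A i k * B j k)) = (\<Sum>i<n - m. x i * (\<Sum>k<n. A i k * B j k))"
      by (subst sum.swap) (simp add: sum_distrib_left)
    also have "\<dots> = 0" using AB[OF _ j] by simp
    also have "(\<Sum>k<n. \<Sum>i<m. y i * (C i k * B j k)) = (\<Sum>i<m. y i * (\<Sum>k<n. C i k * B j k))"
      by (subst sum.swap) (simp add: sum_distrib_left)
    also have "(\<Sum>k<n. x n * (v k * B j k)) = 0"
      using vB[OF j] by (simp flip: sum_distrib_left)
    finally show "(\<Sum>i<m. y i * (\<Sum>k<n. C i k * B j k)) = 0" by simp
  qed
  then have rel: "(\<Sum>i<n - m. x i * A i k) + x n * v k = 0" if "k < n" for k
    using split[OF that] by simp
  \<comment> \<open>Otherwise independence of the \<open>A i\<close> would make the whole relation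
    trivial.\<close>
  have "x n \<noteq> 0"
  proof
    assume xn: "x n = 0"
    then have small: "\<forall>i<n - m. x i = 0" using rel by (intro A) simp
    have "x j = 0"
    proof (cases "j < n - m")
      case False
      then show ?thesis
        using \<open>\<forall>i<m. y i = 0\<close>[rule_format, of "j - (n - m)"] x(1) xn mn
        by (cases "j = n") (auto simp: y_def)
    qed (use small in blast)
    then show False using x(2) by simp
  qed
  show thesis
  proof (rule that)
    fix k assume "k < n"
    have "x n * v k = - (\<Sum>i<n - m. x i * A i k)"
      using rel[OF \<open>k < n\<close>] by (simp add: eq_neg_iff_add_eq_0 add.commute)
    then have "v k = - (\<Sum>i<n - m. x i * A i k) / x n"
      using \<open>x n \<noteq> 0\<close> by (metis nonzero_mult_div_cancel_left)
    then show "v k = (\<Sum>i<n - m. (- x i / x n) * A i k)"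
      by (simp add: sum_divide_distrib sum_negf)
  qed
qed

section \<open>Reduced echelon forms and row spaces\<close>

text \<open>Row reduction is multiplication by an invertible matrix; \<open>W\<close> and
  \<open>V\<close> are that matrix and its inverse, and together they say that both row spaces
  agree.\<close>

lemma rref_obtain:
  fixes A :: "'a::field mat"
  assumes A: "A \<in> carrier_mat nr nc"
  obtains f W V where "rref A \<in> carrier_mat nr nc" "pivot_fun (rref A) f nc"
    "\<And>i k. i < nr \<Longrightarrow> k < nc \<Longrightarrow> rref A $$ (i, k) = (\<Sum>l<nr. W i l * A $$ (l, k))"
    "\<And>i k. i < nr \<Longrightarrow> k < nc \<Longrightarrow> A $$ (i, k) = (\<Sum>l<nr. V i l * rref A $$ (l, k))"
proof -
  note gj = gauss_jordan_single[OF A refl, folded rref_def]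
  obtain P Q where PQ: "rref A = P * A" "P \<in> carrier_mat nr nr" "Q \<in> carrier_mat nr nr"
    "Q * P = 1\<^sub>m nr"
    using gj(4) by blast
  have Q: "A = Q * rref A"
    using PQ A by (simp flip: assoc_mult_mat)
  obtain f where "pivot_fun (rref A) f nc"
    using gj(2,3) unfolding row_echelon_form_def by auto
  moreover have "rref A $$ (i, k) = (\<Sum>l<nr. P $$ (i, l) * A $$ (l, k))" if "i < nr" "k < nc" for i k
    using that PQ(2) A by (simp add: PQ(1) scalar_prod_def lessThan_atLeast0 cong: sum.cong_simp)
  moreover have "A $$ (i, k) = (\<Sum>l<nr. Q $$ (i, l) * rref A $$ (l, k))" if "i < nr" "k < nc" for i k
    using that PQ(3) gj(2)
    by (subst Q) (simp add: scalar_prod_def lessThan_atLeast0 cong: sum.cong_simp)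
  ultimately show thesis using that[of f "\<lambda>i l. P $$ (i, l)" "\<lambda>i l. Q $$ (i, l)"] gj(2) by blast
qed

context
  fixes R :: "'a::field mat" and f nr nc
  assumes R: "R \<in> carrier_mat nr nc" and f: "pivot_fun R f nc"
begin

lemmas pivot = pivot_funD[OF carrier_matD(1)[OF R] f]

lemma pivot_inj:
  assumes "i < nr" "j < nr" "f i = f j" "f i < nc"
  shows "i = j"
  using pivot(4)[of i] pivot(5)[of j i] assms by (metis zero_neq_one)

lemma pivot_ge:
  assumes "i < nr" "f i < nc"
  shows "i \<le> f i"
  using assms
proof (induction i)
  case (Suc i)
  then have "f i < f (Suc i)" using pivot(3)[of i] by auto
  then show ?case using Suc by fastforce
qed simp

text \<open>Pivot columns are unit columns, so the coefficient of row \<open>l\<close> in a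
  row-space vector is that vector's entry at \<open>f l\<close>; rows without a pivot are
  zero.\<close>

lemma row_comb_at_pivots:
  assumes x: "\<And>k. k < nc \<Longrightarrow> x k = (\<Sum>l<nr. w l * R $$ (l, k))" and k: "k < nc"
  shows "x k = (\<Sum>l | l < nr \<and> f l < nc. x (f l) * R $$ (l, k))"
proof -
  have w: "w l = x (f l)" if l: "l < nr" "f l < nc" for l
  proof -
    have "x (f l) = (\<Sum>q<nr. if q = l then w l else 0)"
      unfolding x[OF l(2)] by (rule sum.cong) (use l pivot(4,5) in auto)
    then show ?thesis using l(1) by simp
  qed
  have "x k = (\<Sum>l | l < nr \<and> f l < nc. w l * R $$ (l, k))"
    unfolding x[OF k]
  proof (rule sum.mono_neutral_right)
    show "\<forall>l\<in>{..<nr} - {l. l < nr \<and> f l < nc}. w l * R $$ (l, k) = 0"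
    proof
      fix l assume "l \<in> {..<nr} - {l. l < nr \<and> f l < nc}"
      then have "l < nr" "k < f l" using k by auto
      then show "w l * R $$ (l, k) = 0" using pivot(2)[of l k] by simp
    qed
  qed auto
  also have "\<dots> = (\<Sum>l | l < nr \<and> f l < nc. x (f l) * R $$ (l, k))"
    by (rule sum.cong) (auto simp: w)
  finally show ?thesis .
qed

text \<open>Some pivot row with nonzero coefficient must be nonzero at \<open>k\<close>, and a row
  vanishes to the left of its pivot.\<close>

lemma row_comb_leading_pivot:
  assumes x: "\<And>k. k < nc \<Longrightarrow> x k = (\<Sum>l<nr. w l * R $$ (l, k))"
    and k: "k < nc" "x k \<noteq> 0"
  obtains l where "l < nr" "f l \<le> k" "x (f l) \<noteq> 0"
proof -
  have "(\<Sum>l | l < nr \<and> f l < nc. x (f l) * R $$ (l, k)) \<noteq> 0"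
    using row_comb_at_pivots[OF x k(1)] k(2) by simp
  then obtain l where l: "l < nr" "f l < nc" "x (f l) * R $$ (l, k) \<noteq> 0"
    by (rule sum.not_neutral_contains_not_neutral) auto
  then have "R $$ (l, k) \<noteq> 0" by auto
  then have "f l \<le> k" using pivot(2)[of l k] l(1) not_le by blast
  then show thesis using that l by auto
qed

text \<open>The only pivot at which a unit vector can be nonzero is \<open>f l = j\<close>, so its
  expansion at the pivots consists of row \<open>l\<close> alone.\<close>

lemma unit_row_in_echelon_form:
  assumes j: "j < nc"
    and w: "\<And>k. k < nc \<Longrightarrow> (if k = j then 1 else 0) = (\<Sum>l<nr. w l * R $$ (l, k))"
  obtains i where "i < nr" "row R i = unit_vec nc j"
proof -
  let ?x = "\<lambda>k. if k = j then 1 else 0 :: 'a"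
  obtain l where l: "l < nr" "?x (f l) \<noteq> 0"
    by (rule row_comb_leading_pivot[of ?x w, OF w j]) auto
  then have fl: "f l = j" by (auto split: if_splits)
  have "row R l = unit_vec nc j"
  proof (rule eq_vecI)
    fix k assume "k < dim_vec (unit_vec nc j :: 'a vec)"
    then have k: "k < nc" by simp
    have "?x k = (\<Sum>q | q < nr \<and> f q < nc. ?x (f q) * R $$ (q, k))"
      by (rule row_comb_at_pivots[of ?x w, OF w k])
    also have "\<dots> = (\<Sum>q | q < nr \<and> f q < nc. if q = l then R $$ (l, k) else 0)"
      by (rule sum.cong) (use pivot_inj l fl in auto)
    also have "\<dots> = R $$ (l, k)"
      using l fl j by simp
    finally show "row R l $ k = unit_vec nc j $ k"
      using l k j R by simp
  qed (use R in simp)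
  then show thesis using that l by blast
qed

end

lemma rref_unit_row:
  fixes A :: "'a::field mat"
  assumes A: "A \<in> carrier_mat nr nc" and j: "j < nc"
  shows "(\<exists>i<nr. row (rref A) i = unit_vec nc j) \<longleftrightarrow>
    (\<exists>w. \<forall>k<nc. (\<Sum>l<nr. w l * A $$ (l, k)) = (if k = j then 1 else 0))"
proof -
  obtain f W V where R: "rref A \<in> carrier_mat nr nc" "pivot_fun (rref A) f nc"
    and W: "\<And>i k. i < nr \<Longrightarrow> k < nc \<Longrightarrow> rref A $$ (i, k) = (\<Sum>l<nr. W i l * A $$ (l, k))"
    and V: "\<And>i k. i < nr \<Longrightarrow> k < nc \<Longrightarrow> A $$ (i, k) = (\<Sum>l<nr. V i l * rref A $$ (l, k))"
    by (rule rref_obtain[OF A]) blast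
  show ?thesis
  proof
    assume "\<exists>i<nr. row (rref A) i = unit_vec nc j"
    then obtain i where i: "i < nr" "row (rref A) i = unit_vec nc j" by blast
    have "rref A $$ (i, k) = (if k = j then 1 else 0)" if "k < nc" for k
    proof -
      have "row (rref A) i $ k = rref A $$ (i, k)" using i(1) R(1) that by simp
      then show ?thesis using i(2) that j by simp
    qed
    then show "\<exists>w. \<forall>k<nc. (\<Sum>l<nr. w l * A $$ (l, k)) = (if k = j then 1 else 0)"
      using W[OF i(1)] by (intro exI[of _ "W i"]) auto
  next
    assume "\<exists>w. \<forall>k<nc. (\<Sum>l<nr. w l * A $$ (l, k)) = (if k = j then 1 else 0)"
    then obtain w where w: "\<And>k. k < nc \<Longrightarrow> (\<Sum>l<nr. w l * A $$ (l, k)) = (if k = j then 1 else 0)"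
      by blast
    have "(if k = j then 1 else 0) = (\<Sum>q<nr. (\<Sum>l<nr. w l * V l q) * rref A $$ (q, k))"
      if k: "k < nc" for k
    proof -
      have "(if k = j then 1 else 0) = (\<Sum>l<nr. \<Sum>q<nr. w l * V l q * rref A $$ (q, k))"
        unfolding w[OF k, symmetric]
        by (rule sum.cong) (simp_all add: V k sum_distrib_left mult.assoc)
      also have "\<dots> = (\<Sum>q<nr. \<Sum>l<nr. w l * V l q * rref A $$ (q, k))" by (rule sum.swap)
      finally show ?thesis by (simp add: sum_distrib_right)
    qed
    then obtain i where "i < nr" "row (rref A) i = unit_vec nc j"
      by (rule unit_row_in_echelon_form[OF R j])
    then show "\<exists>i<nr. row (rref A) i = unit_vec nc j" by blast
  qed
qed

text \<open>\<open>inj\<close> and \<open>surj\<close> say that the projection of the row space to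
  the first \<open>m\<close> coordinates is injective and onto; hence precisely these columns carry
  the pivots.\<close>

lemma rref_leading_identity:
  fixes A :: "'a::field mat"
  assumes A: "A \<in> carrier_mat nr nc" and m: "m \<le> nc"
    and inj: "\<And>w. (\<And>k. k < m \<Longrightarrow> (\<Sum>l<nr. w l * A $$ (l, k)) = 0) \<Longrightarrow>
      \<forall>k<nc. (\<Sum>l<nr. w l * A $$ (l, k)) = 0"
    and surj: "\<And>i. i < m \<Longrightarrow> \<exists>w. \<forall>k<m. (\<Sum>l<nr. w l * A $$ (l, k)) = (if k = i then 1 else 0)"
  shows "\<And>i k. i < nr \<Longrightarrow> k < m \<Longrightarrow> rref A $$ (i, k) = (if i = k then 1 else 0)"
    and "\<And>i k. m \<le> i \<Longrightarrow> i < nr \<Longrightarrow> k < nc \<Longrightarrow> rref A $$ (i, k) = 0"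
proof -
  obtain f W V where R: "rref A \<in> carrier_mat nr nc" "pivot_fun (rref A) f nc"
    and W: "\<And>i k. i < nr \<Longrightarrow> k < nc \<Longrightarrow> rref A $$ (i, k) = (\<Sum>l<nr. W i l * A $$ (l, k))"
    and V: "\<And>i k. i < nr \<Longrightarrow> k < nc \<Longrightarrow> A $$ (i, k) = (\<Sum>l<nr. V i l * rref A $$ (l, k))"
    by (rule rref_obtain[OF A]) blast
  note pivot = pivot_funD[OF carrier_matD(1)[OF R(1)] R(2)]
  \<comment> \<open>A row-space vector projecting to the \<open>i\<close>-th unit vector is nonzero
    at some pivot not beyond \<open>i\<close>, and this can only be \<open>i\<close>.\<close>
  have hit: "\<exists>r<nr. f r = i" if i: "i < m" for i
  proof -
    obtain w where w: "\<And>k. k < m \<Longrightarrow> (\<Sum>l<nr. w l * A $$ (l, k)) = (if k = i then 1 else 0)"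
      using surj[OF i] by blast
    define x where "x k = (\<Sum>l<nr. w l * A $$ (l, k))" for k
    have "x k = (\<Sum>q<nr. (\<Sum>l<nr. w l * V l q) * rref A $$ (q, k))" if k: "k < nc" for k
    proof -
      have "x k = (\<Sum>l<nr. \<Sum>q<nr. w l * V l q * rref A $$ (q, k))"
        unfolding x_def by (rule sum.cong) (simp_all add: V k sum_distrib_left mult.assoc)
      also have "\<dots> = (\<Sum>q<nr. \<Sum>l<nr. w l * V l q * rref A $$ (q, k))" by (rule sum.swap)
      finally show ?thesis by (simp add: sum_distrib_right)
    qed
    moreover have "i < nc" "x i \<noteq> 0" using i m w[OF i] by (simp_all add: x_def)
    ultimately obtain r where r: "r < nr" "f r \<le> i" "x (f r) \<noteq> 0"
      by (rule row_comb_leading_pivot[OF R])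
    then have "f r = i" using w[of "f r"] i by (auto simp: x_def split: if_splits)
    then show ?thesis using r by blast
  qed
  have fi: "i < nr \<and> f i = i" if "i < m" for i
    using that
  proof (induction i rule: less_induct)
    case (less i)
    obtain r where r: "r < nr" "f r = i" using hit[OF less.prems] by blast
    then have "r \<le> i" using pivot_ge[OF R r(1)] less.prems m by simp
    then show ?case using less r by (metis le_neq_implies_less less_trans nat_neq_iff)
  qed
  show id: "rref A $$ (i, k) = (if i = k then 1 else 0)" if "i < nr" "k < m" for i k
    using fi[OF that(2)] pivot(4)[of k] pivot(5)[of k i] that m by auto
  show "rref A $$ (i, k) = 0" if "m \<le> i" "i < nr" "k < nc" for i k
  proof -
    have "\<forall>k<nc. (\<Sum>l<nr. W i l * A $$ (l, k)) = 0"
    proof (rule inj)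
      fix k assume "k < m"
      then show "(\<Sum>l<nr. W i l * A $$ (l, k)) = 0"
        using id[of i k] W[of i k] that m by auto
    qed
    then show ?thesis using W that by simp
  qed
qed

lemma rank_of_leading_columns:
  fixes A :: "'a::field mat"
  assumes A: "A \<in> carrier_mat nr nc" and m: "m \<le> nc"
    and indep: "\<And>x. (\<And>i. i < nr \<Longrightarrow> (\<Sum>j<m. x j * A $$ (i, j)) = 0) \<Longrightarrow> \<forall>j<m. x j = 0"
    and span: "\<And>j. j < nc \<Longrightarrow> \<exists>y. \<forall>i<nr. A $$ (i, j) = (\<Sum>l<m. y l * A $$ (i, l))"
  shows "vec_space.rank nr A = m"
proof -
  interpret V: vec_space "TYPE('a)" nr .
  define B where "B = mat nr m (\<lambda>(i, j). A $$ (i, j))"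
  have B: "B \<in> carrier_mat nr m" by (simp add: B_def)
  have colB: "col B j = col A j" if "j < m" for j
    using that m A by (intro eq_vecI) (auto simp: B_def)
  have mul: "(B *\<^sub>v v) $ i = (\<Sum>j<m. v $ j * A $$ (i, j))" if "v \<in> carrier_vec m" "i < nr" for v i
    using that
    by (simp add: B_def scalar_prod_def lessThan_atLeast0 mult.commute[of "v $ _"] cong: sum.cong_simp)
  have inj: "v = 0\<^sub>v m" if v: "v \<in> carrier_vec m" "B *\<^sub>v v = 0\<^sub>v nr" for v
  proof -
    have "\<forall>j<m. v $ j = 0"
    proof (rule indep)
      fix i assume "i < nr"
      then show "(\<Sum>j<m. v $ j * A $$ (i, j)) = 0" using mul[OF v(1), of i] v(2) \<open>i < nr\<close> by simp
    qed
    then show ?thesis using v(1) by auto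
  qed
  \<comment> \<open>Independence is stated for the set of columns, where repetitions would collapse,
    so distinctness comes first.\<close>
  have dist: "distinct (cols B)"
  proof (rule ccontr)
    assume "\<not> distinct (cols B)"
    then obtain i j where ij: "i < m" "j < m" "i \<noteq> j" "col B i = col B j"
      using B by (auto simp: distinct_conv_nth)
    have "B *\<^sub>v unit_vec m q = col B q" if "q < m" for q
      by (rule eq_vecI) (use that B in \<open>simp_all add: scalar_prod_right_unit\<close>)
    then have "B *\<^sub>v (unit_vec m i - unit_vec m j) = 0\<^sub>v nr"
      using ij B by (simp add: mult_minus_distrib_mat_vec[OF B])
    then have "unit_vec m i - unit_vec m j = (0\<^sub>v m :: 'a vec)" by (intro inj) auto
    then have "(unit_vec m i - unit_vec m j) $ i = (0\<^sub>v m :: 'a vec) $ i" by simp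
    then show False using ij by simp
  qed
  have li: "V.lin_indpt (set (cols B))"
    using V.lin_depE[OF B _ dist] inj by blast
  have sub: "set (cols B) \<subseteq> set (cols A)"
    using A B m colB by (auto simp: cols_def)
  have cA: "set (cols A) \<subseteq> carrier_vec nr" and cB: "set (cols B) \<subseteq> carrier_vec nr"
    using A B cols_dim by blast+
  have "set (cols A) \<subseteq> V.span (set (cols B))"
  proof
    fix a assume "a \<in> set (cols A)"
    then obtain j where j: "j < nc" "a = col A j" using A by (auto simp: cols_def)
    obtain y where y: "\<forall>i<nr. A $$ (i, j) = (\<Sum>l<m. y l * A $$ (i, l))" using span[OF j(1)] by blast
    have "a = B *\<^sub>v vec m y"
    proof (rule eq_vecI)
      fix i assume "i < dim_vec (B *\<^sub>v vec m y)"
      then have "i < nr" using B by simp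
      then show "a $ i = (B *\<^sub>v vec m y) $ i" using j A y mul[of "vec m y" i] by simp
    qed (use j A B in simp)
    also have "\<dots> = V.lincomb (\<lambda>a. vec m y $ find_first a (cols B)) (set (cols B))"
      by (rule V.lincomb_eq_mat_mult[OF B _ dist, symmetric]) simp
    also have "\<dots> \<in> V.span (set (cols B))"
      unfolding V.span_def by blast
    finally show "a \<in> V.span (set (cols B))" .
  qed
  then have "V.span (set (cols A)) = V.span (set (cols B))"
    using cA cB sub by (metis V.span_is_monotone V.span_is_submodule V.span_is_subset subset_antisym)
  then have "V.rank A = V.rank B" unfolding V.rank_def by simp
  then show ?thesis using V.lin_indpt_full_rank[OF B dist li] by simp
qed

text \<open>Every kept row is a unit vector, so column \<open>j\<close> can be nonzero only through
  the unit vector at \<open>j\<close>.\<close>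

lemma zero_columns_keep_unit_rows:
  fixes H :: "'a::field mat"
  assumes H: "H \<in> carrier_mat nr nc"
  shows "zero_columns (keep_unit_rows H) = {j. j < nc \<and> \<not> (\<exists>i<nr. row H i = unit_vec nc j)}"
proof -
  define us where "us = filter (\<lambda>r. \<exists>i<nc. r = unit_vec nc i) (rows H)"
  have kur: "keep_unit_rows H = mat_of_rows nc us"
    using H by (simp add: keep_unit_rows_def us_def)
  have us: "set us = {r. (\<exists>i<nr. row H i = r) \<and> (\<exists>p<nc. r = unit_vec nc p)}"
    using H by (auto simp: us_def rows_def)
  have "col (mat_of_rows nc us) j = 0\<^sub>v (length us) \<longleftrightarrow> unit_vec nc j \<notin> set us" if j: "j < nc" for j
  proof -
    have "col (mat_of_rows nc us) j = 0\<^sub>v (length us) \<longleftrightarrow> (\<forall>l<length us. us ! l $ j = 0)"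
      using j by (auto simp: vec_eq_iff mat_of_rows_index)
    also have "\<dots> \<longleftrightarrow> (\<forall>r\<in>set us. r $ j = 0)" by (simp add: all_set_conv_all_nth)
    also have "\<dots> \<longleftrightarrow> unit_vec nc j \<notin> set us"
    proof
      assume "\<forall>r\<in>set us. r $ j = 0"
      then show "unit_vec nc j \<notin> set us" using j by force
    next
      assume nj: "unit_vec nc j \<notin> set us"
      show "\<forall>r\<in>set us. r $ j = 0"
      proof
        fix r assume r: "r \<in> set us"
        then obtain p where "p < nc" "r = unit_vec nc p" unfolding us by blast
        then show "r $ j = 0" using r nj j by (cases "p = j") auto
      qed
    qed
    finally show ?thesis .
  qed
  then have "zero_columns (keep_unit_rows H) = {j. j < nc \<and> unit_vec nc j \<notin> set us}"
    unfolding kur zero_columns_def by auto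
  also have "\<dots> = {j. j < nc \<and> \<not> (\<exists>i<nr. row H i = unit_vec nc j)}"
    unfolding us by auto
  finally show ?thesis .
qed

section \<open>Moore systems and skew evaluation\<close>

text \<open>If \<open>c k0 = 1\<close>, subtracting each equation from \<open>\<sigma>\<close> of its predecessor eliminates the index
  \<open>k0\<close> and leaves a system of the same kind for \<open>\<sigma> (c k) - c k\<close>, so all \<open>c k\<close> are
  invariant.\<close>

lemma moore_kernel_trivial:
  fixes \<sigma> :: "'a::field \<Rightarrow> 'a"
  assumes "field_hom \<sigma>" "finite K"
    and "\<And>d. (\<And>k. k \<in> K \<Longrightarrow> \<sigma> (d k) = d k) \<Longrightarrow> (\<Sum>k\<in>K. d k * z k) = 0 \<Longrightarrow> \<forall>k\<in>K. d k = 0"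
    and "\<And>i. i < card K \<Longrightarrow> (\<Sum>k\<in>K. c k * (\<sigma> ^^ i) (z k)) = 0"
  shows "\<forall>k\<in>K. c k = 0"
  using assms(2-)
proof (induction "card K" arbitrary: K z c)
  case 0
  then show ?case by simp
next
  case (Suc m)
  interpret s: field_hom \<sigma> by fact
  show ?case
  proof (rule ccontr)
    assume "\<not> (\<forall>k\<in>K. c k = 0)"
    then obtain k0 where k0: "k0 \<in> K" "c k0 \<noteq> 0" by blast
    \<comment> \<open>Scaling to value 1 at \<open>k0\<close> makes
      \<open>\<sigma> (b k) - b k\<close> vanish there.\<close>
    define b where "b k = c k / c k0" for k
    have b: "(\<Sum>k\<in>K. b k * (\<sigma> ^^ i) (z k)) = 0" if "i < Suc m" for i
      using Suc.prems(3)[of i] Suc.hyps(2) that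
      by (simp add: b_def sum_divide_distrib[symmetric])
    have bk0: "b k0 = 1" using k0 by (simp add: b_def)
    define K' where "K' = K - {k0}"
    have fin: "finite K'" and card: "card K' = m"
      using Suc.prems(1) Suc.hyps(2) k0 by (simp_all add: K'_def)
    have "\<forall>k\<in>K'. \<sigma> (b k) - b k = 0"
    proof (rule Suc.hyps(1)[where z = "\<lambda>k. \<sigma> (z k)"])
      fix d :: "'b \<Rightarrow> 'a"
      assume d: "\<And>k. k \<in> K' \<Longrightarrow> \<sigma> (d k) = d k" and rel: "(\<Sum>k\<in>K'. d k * \<sigma> (z k)) = 0"
      \<comment> \<open>Independence passes from \<open>z\<close> to its image: a relation with
        invariant coefficients, extended by 0 to \<open>k0\<close>, is the image of a relation for
        \<open>z\<close> under the injective \<open>\<sigma>\<close>.\<close>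
      define d' where "d' k = (if k = k0 then 0 else d k)" for k
      have "\<sigma> (\<Sum>k\<in>K. d' k * z k) = (\<Sum>k\<in>K. d' k * \<sigma> (z k))"
        unfolding s.hom_sum s.hom_mult by (rule sum.cong) (use d in \<open>auto simp: d'_def K'_def\<close>)
      also have "\<dots> = (\<Sum>k\<in>K'. d' k * \<sigma> (z k))"
        using k0 Suc.prems(1) by (simp add: K'_def sum.remove[of K k0] d'_def)
      also have "\<dots> = (\<Sum>k\<in>K'. d k * \<sigma> (z k))"
        by (rule sum.cong) (auto simp: d'_def K'_def)
      finally have "(\<Sum>k\<in>K. d' k * z k) = 0" using rel by simp
      then have "\<forall>k\<in>K. d' k = 0"
        using d by (intro Suc.prems(2)) (auto simp: d'_def K'_def)
      then show "\<forall>k\<in>K'. d k = 0" unfolding d'_def K'_def by (metis DiffE singletonI)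
    next
      fix i assume "i < card K'"
      then have i: "i < m" by (simp add: card)
      have "\<sigma> (\<Sum>k\<in>K. b k * (\<sigma> ^^ i) (z k)) = 0" using b[of i] i by simp
      then have "(\<Sum>k\<in>K. \<sigma> (b k) * (\<sigma> ^^ Suc i) (z k)) = 0"
        by (simp add: s.hom_sum s.hom_mult)
      then have "(\<Sum>k\<in>K. (\<sigma> (b k) - b k) * (\<sigma> ^^ Suc i) (z k)) = 0"
        using b[of "Suc i"] i by (simp add: left_diff_distrib sum_subtractf)
      then show "(\<Sum>k\<in>K'. (\<sigma> (b k) - b k) * (\<sigma> ^^ i) (\<sigma> (z k))) = 0"
        using k0 Suc.prems(1) bk0
        by (simp add: K'_def sum.remove[of K k0] funpow_swap1)
    qed (use fin card in simp_all)
    then have "\<And>k. k \<in> K \<Longrightarrow> \<sigma> (b k) = b k" using bk0 by (auto simp: K'_def)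
    moreover have "(\<Sum>k\<in>K. b k * z k) = 0" using b[of 0] by simp
    ultimately have "\<forall>k\<in>K. b k = 0" by (rule Suc.prems(2))
    then show False using k0 bk0 by auto
  qed
qed

section \<open>Skew polynomials as operators\<close>

text \<open>Here \<open>x\<close> acts as \<open>\<sigma>\<close>, so products become compositions.
  This differs from the remainder evaluation built on \<open>skew_norm\<close>; \<open>z\<close> is
  a root of \<open>x - b\<close> when \<open>\<sigma> z = b * z\<close>.\<close>

definition skew_eval :: "('a::field \<Rightarrow> 'a) \<Rightarrow> 'a poly \<Rightarrow> 'a \<Rightarrow> 'a" where
  "skew_eval \<sigma> f z = (\<Sum>i\<le>degree f. coeff f i * (\<sigma> ^^ i) z)"

lemma skew_eval_bound:
  assumes "\<And>i. i \<ge> N \<Longrightarrow> coeff f i = 0"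
  shows "skew_eval \<sigma> f z = (\<Sum>i<N. coeff f i * (\<sigma> ^^ i) z)"
proof -
  have "skew_eval \<sigma> f z = (\<Sum>i<max N (Suc (degree f)). coeff f i * (\<sigma> ^^ i) z)"
    unfolding skew_eval_def by (rule sum.mono_neutral_left) (auto simp: coeff_eq_0)
  also have "\<dots> = (\<Sum>i<N. coeff f i * (\<sigma> ^^ i) z)"
    by (rule sum.mono_neutral_right) (auto simp: assms)
  finally show ?thesis .
qed

lemma skew_eval_add: "skew_eval \<sigma> (f + g) z = skew_eval \<sigma> f z + skew_eval \<sigma> g z"
proof -
  let ?N = "Suc (max (degree f) (degree g))"
  have "degree (f + g) < ?N" using degree_add_le_max[of f g] by simp
  then have "skew_eval \<sigma> h z = (\<Sum>i<?N. coeff h i * (\<sigma> ^^ i) z)" if "h \<in> {f, g, f + g}" for h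
    using that by (intro skew_eval_bound) (auto simp: coeff_eq_0)
  then show ?thesis by (simp add: distrib_right sum.distrib)
qed

lemma skew_eval_0: "skew_eval \<sigma> 0 z = 0"
  by (simp add: skew_eval_def)

lemma skew_eval_uminus: "skew_eval \<sigma> (- f) z = - skew_eval \<sigma> f z"
  by (simp add: skew_eval_def sum_negf)

lemma skew_eval_sum: "finite A \<Longrightarrow> skew_eval \<sigma> (\<Sum>a\<in>A. h a) z = (\<Sum>a\<in>A. skew_eval \<sigma> (h a) z)"
  by (induction A rule: finite_induct) (simp_all add: skew_eval_0 skew_eval_add)

lemma skew_eval_monom: "skew_eval \<sigma> (monom c i) z = c * (\<sigma> ^^ i) z"
  by (subst skew_eval_bound[of "Suc i"]) (auto simp: if_distrib[of "\<lambda>c. c * _"] cong: if_cong)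

lemma skew_eval_mult:
  assumes "field_hom \<sigma>"
  shows "skew_eval \<sigma> (skew_mult \<sigma> f g) z = skew_eval \<sigma> f (skew_eval \<sigma> g z)"
proof -
  have hom: "(\<sigma> ^^ i) (\<Sum>j\<le>degree g. coeff g j * (\<sigma> ^^ j) z) =
      (\<Sum>j\<le>degree g. (\<sigma> ^^ i) (coeff g j) * (\<sigma> ^^ (i + j)) z)" for i
  proof -
    interpret s: field_hom "\<sigma> ^^ i" by (rule funpow_field_hom[OF assms])
    show ?thesis by (simp add: s.hom_sum s.hom_mult funpow_add)
  qed
  have "skew_eval \<sigma> (skew_mult \<sigma> f g) z = (\<Sum>i\<le>degree f. \<Sum>j\<le>degree g.
      coeff f i * (\<sigma> ^^ i) (coeff g j) * (\<sigma> ^^ (i + j)) z)"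
    by (simp add: skew_mult_def skew_eval_sum skew_eval_monom)
  also have "\<dots> = skew_eval \<sigma> f (skew_eval \<sigma> g z)"
    unfolding skew_eval_def[of \<sigma> f] by (subst skew_eval_def) (simp add: hom sum_distrib_left mult.assoc)
  finally show ?thesis .
qed

lemma skew_eval_at_0:
  assumes "field_hom \<sigma>"
  shows "skew_eval \<sigma> f 0 = 0"
proof -
  have "(\<sigma> ^^ i) 0 = 0" for i
  proof -
    interpret s: field_hom "\<sigma> ^^ i" by (rule funpow_field_hom[OF assms])
    show ?thesis by simp
  qed
  then show ?thesis by (simp add: skew_eval_def)
qed

text \<open>The skew polynomials that act as zero form a two-sided ideal containing
  \<open>x^n - 1\<close>, because \<open>\<sigma> ^^ n = id\<close>. Evaluation is therefore well
  defined on residue classes.\<close>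

lemma modulus_ideal_skew_eval:
  assumes hom: "field_hom \<sigma>" and ord: "\<sigma> ^^ n = id" "0 < n" and f: "f \<in> modulus_ideal \<sigma> n"
  shows "skew_eval \<sigma> f z = 0"
proof -
  let ?R = "skew_poly_ring \<sigma>"
  let ?I = "{f. \<forall>z. skew_eval \<sigma> f z = 0}"
  interpret R: ring ?R by (rule ring_skew_poly_ring[OF hom])
  have minus: "a_inv ?R f = - f" for f
    by (rule R.minus_equality) (simp_all add: skew_poly_ring_def)
  have "ideal ?I ?R"
  proof (rule idealI)
    show "ring ?R" by (rule R.ring_axioms)
    show "subgroup ?I (add_monoid ?R)"
    proof (rule R.add.subgroupI)
      show "?I \<noteq> {}" using skew_eval_0[of \<sigma>] by auto
      show "\<And>a. a \<in> ?I \<Longrightarrow> \<ominus>\<^bsub>?R\<^esub> a \<in> ?I" by (simp add: minus skew_eval_uminus)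
    qed (simp_all add: skew_poly_ring_def skew_eval_add)
  qed (simp_all add: skew_poly_ring_def skew_eval_mult[OF hom] skew_eval_at_0[OF hom])
  moreover have "monom 1 n - 1 \<in> ?I"
  proof -
    have "monom 1 n - 1 = monom 1 n + - monom (1::'a) 0" by (simp add: monom_0 one_pCons)
    then have "skew_eval \<sigma> (monom 1 n - 1) z = 0" for z
      by (simp only: skew_eval_add skew_eval_uminus skew_eval_monom) (simp add: ord)
    then show ?thesis by simp
  qed
  ultimately show ?thesis using f by (auto simp: modulus_ideal_def genideal_def)
qed

text \<open>Being a member of its own left ideal, \<open>g\<close> is a left multiple of
  \<open>x - b\<close>, and this right factor already sends \<open>z\<close> to 0.\<close>

lemma lclm_skew_eval:
  assumes hom: "field_hom \<sigma>" and g: "is_lclm \<sigma> F g" and f: "[:- b, 1:] \<in> F"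
    and z: "\<sigma> z = b * z"
  shows "skew_eval \<sigma> g z = 0"
proof -
  interpret R: ring "skew_poly_ring \<sigma>" by (rule ring_skew_poly_ring[OF hom])
  have "\<one>\<^bsub>skew_poly_ring \<sigma>\<^esub> \<otimes>\<^bsub>skew_poly_ring \<sigma>\<^esub> g = g"
    by (rule R.l_one) (simp add: skew_poly_ring_def)
  then have "g \<in> left_principal_ideal (skew_poly_ring \<sigma>) g"
    unfolding left_principal_ideal_def using R.one_closed by (metis image_eqI)
  then have "g \<in> left_principal_ideal (skew_poly_ring \<sigma>) [:- b, 1:]"
    using g f by (auto simp: is_lclm_def)
  then obtain h where "g = skew_mult \<sigma> h [:- b, 1:]"
    by (auto simp: left_principal_ideal_def skew_poly_ring_def)
  moreover have "skew_eval \<sigma> [:- b, 1:] z = 0"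
    using z by (simp add: skew_eval_def)
  ultimately show ?thesis by (simp add: skew_eval_mult[OF hom] skew_eval_at_0[OF hom])
qed

text \<open>The class of \<open>c\<close> is that of a left multiple of \<open>g\<close>, and both
  \<open>g\<close> and the modulus ideal send \<open>z\<close> to 0.\<close>

lemma codeword_skew_eval:
  assumes hom: "field_hom \<sigma>" and ord: "\<sigma> ^^ n = id" "0 < n"
    and c: "vec_to_class \<sigma> n c \<in>
      left_principal_ideal (skew_quotient_ring \<sigma> n) (residue_class \<sigma> n g)"
    and g: "skew_eval \<sigma> g z = 0"
  shows "(\<Sum>j<n. c $ j * (\<sigma> ^^ j) z) = 0"
proof -
  let ?R = "skew_poly_ring \<sigma>"
  let ?I = "modulus_ideal \<sigma> n"
  interpret R: ring ?R by (rule ring_skew_poly_ring[OF hom])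
  have ideal: "ideal ?I ?R"
    unfolding modulus_ideal_def by (rule R.genideal_ideal) (simp add: skew_poly_ring_def)
  define p where "p = (\<Sum>i<n. monom (c $ i) i)"
  have zero: "skew_eval \<sigma> i z = 0" if "i \<in> ?I" for i
    using modulus_ideal_skew_eval[OF hom ord that] .
  have coset: "I +>\<^bsub>?R\<^esub> f = (\<lambda>i. i + f) ` I" for I f
    by (auto simp: a_r_coset_def r_coset_def skew_poly_ring_def)
  have "0 \<in> ?I"
    using additive_subgroup.zero_closed[OF ideal.axioms(1)[OF ideal]] by (simp add: skew_poly_ring_def)
  then have "p \<in> vec_to_class \<sigma> n c"
    unfolding vec_to_class_def residue_class_def coset p_def by force
  then obtain A where "p \<in> rcoset_mult ?R ?I A (residue_class \<sigma> n g)"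
    using c unfolding left_principal_ideal_def skew_quotient_ring_def FactRing_def by auto
  \<comment> \<open>The product of a coset \<open>A\<close> with the coset of \<open>g\<close>
    consists of products of representatives \<open>a\<close> and \<open>i + g\<close>, shifted by
    the ideal.\<close>
  then obtain a i i' where "p = i' + skew_mult \<sigma> a (i + g)" "i \<in> ?I" "i' \<in> ?I"
    unfolding rcoset_mult_def residue_class_def coset by (auto simp: skew_poly_ring_def)
  then have "skew_eval \<sigma> p z = 0"
    by (simp add: skew_eval_add skew_eval_mult[OF hom] zero g skew_eval_at_0[OF hom])
  then show ?thesis by (simp add: p_def skew_eval_sum skew_eval_monom)
qed

section \<open>The syndrome matrix and the error locator\<close>

locale normal_automorphism = field_hom \<sigma> for \<sigma> :: "'a::field \<Rightarrow> 'a" +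
  fixes n :: nat and \<alpha> :: 'a
  assumes bij: "bij \<sigma>" and order: "\<sigma> ^^ n = id" "0 < n" and normal: "normal_basis \<sigma> n \<alpha>"
begin

definition basis_elem :: "nat \<Rightarrow> 'a" where
  "basis_elem k = (\<sigma> ^^ k) \<alpha>"

lemma pow_field_hom: "field_hom (\<sigma> ^^ i)"
  by (rule funpow_field_hom) (rule field_hom_axioms)

lemma pow_hom:
  "(\<sigma> ^^ i) 0 = 0" "(\<sigma> ^^ i) (x * y) = (\<sigma> ^^ i) x * (\<sigma> ^^ i) y"
  "(\<sigma> ^^ i) (inverse x) = inverse ((\<sigma> ^^ i) x)"
  "(\<sigma> ^^ i) x = 0 \<longleftrightarrow> x = 0" "(\<sigma> ^^ i) 1 = 1"
  "(\<sigma> ^^ i) (sum f A) = (\<Sum>a\<in>A. (\<sigma> ^^ i) (f a))"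
proof -
  interpret s: field_hom "\<sigma> ^^ i" by (rule pow_field_hom)
  show "(\<sigma> ^^ i) 0 = 0" "(\<sigma> ^^ i) (x * y) = (\<sigma> ^^ i) x * (\<sigma> ^^ i) y"
    "(\<sigma> ^^ i) (inverse x) = inverse ((\<sigma> ^^ i) x)"
    "(\<sigma> ^^ i) x = 0 \<longleftrightarrow> x = 0" "(\<sigma> ^^ i) 1 = 1"
    "(\<sigma> ^^ i) (sum f A) = (\<Sum>a\<in>A. (\<sigma> ^^ i) (f a))"
    by (simp_all add: s.hom_mult s.hom_inverse s.hom_sum)
qed

lemma pow_basis_elem [simp]: "(\<sigma> ^^ i) (basis_elem k) = basis_elem (i + k)"
  by (simp add: basis_elem_def funpow_add)

lemma hom_basis_elem [simp]: "\<sigma> (basis_elem k) = basis_elem (Suc k)"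
  by (simp add: basis_elem_def)

lemma basis_elem_independent:
  assumes "K \<subseteq> {..<n}" "\<And>k. k \<in> K \<Longrightarrow> \<sigma> (d k) = d k" "(\<Sum>k\<in>K. d k * basis_elem k) = 0"
  shows "\<forall>k\<in>K. d k = 0"
proof -
  define d' where "d' k = (if k \<in> K then d k else 0)" for k
  have "(\<Sum>i<n. d' i * (\<sigma> ^^ i) \<alpha>) = (\<Sum>k\<in>K. d' k * basis_elem k)"
    unfolding basis_elem_def by (rule sum.mono_neutral_right) (use assms(1) in \<open>auto simp: d'_def\<close>)
  also have "\<dots> = (\<Sum>k\<in>K. d k * basis_elem k)" by (rule sum.cong) (simp_all add: d'_def)
  finally have "(\<Sum>i<n. d' i * (\<sigma> ^^ i) \<alpha>) = 0" using assms(3) by simp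
  moreover have "\<forall>i<n. d' i \<in> invariant_field \<sigma>"
    using assms(2) by (simp add: invariant_field_def d'_def)
  ultimately have "\<forall>i<n. d' i = 0" using normal unfolding normal_basis_def by blast
  then show ?thesis using assms(1) by (auto simp: d'_def)
qed

text \<open>Coefficients on \<open>K\<close> are determined by \<open>card K\<close> consecutive
  sums; in this form the normal basis is applied to errors, syndromes and locators.\<close>

lemma basis_elem_moore:
  assumes "K \<subseteq> {..<n}" "\<And>i. i < card K \<Longrightarrow> (\<Sum>k\<in>K. c k * basis_elem (i + k)) = 0"
  shows "\<forall>k\<in>K. c k = 0"
proof (rule moore_kernel_trivial[OF field_hom_axioms])
  show "finite K" using assms(1) finite_subset by blast
  show "(\<Sum>k\<in>K. c k * (\<sigma> ^^ i) (basis_elem k)) = 0" if "i < card K" for i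
    using assms(2)[OF that] by simp
qed (rule basis_elem_independent[OF assms(1)])

lemma basis_elem_nonzero [simp]: "basis_elem k \<noteq> 0"
proof
  assume "basis_elem k = 0"
  then have "\<alpha> = 0" unfolding basis_elem_def pow_hom(4) .
  moreover have "basis_elem 0 = \<alpha>" by (simp add: basis_elem_def)
  ultimately have "basis_elem 0 = 0" by (rule trans[rotated])
  then show False using basis_elem_independent[of "{0}" "\<lambda>_. 1"] order(2) by simp
qed

text \<open>The product telescopes, since \<open>\<sigma> ^^ j\<close> sends
  \<open>inverse \<alpha> * \<sigma> \<alpha>\<close> to the quotient of the basis elements with
  indices \<open>j + 1\<close> and \<open>j\<close>.\<close>

lemma skew_norm_basis_elem: "skew_norm \<sigma> i ((\<sigma> ^^ j) (inverse \<alpha> * \<sigma> \<alpha>)) = basis_elem (i + j) / basis_elem j"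
proof (induction i)
  case 0
  then show ?case by (simp add: skew_norm_def)
next
  case (Suc i)
  have "(\<sigma> ^^ i) ((\<sigma> ^^ j) (inverse \<alpha> * \<sigma> \<alpha>)) = basis_elem (Suc (i + j)) / basis_elem (i + j)"
    using pow_hom(2,3)[of "i + j"]
    by (simp add: basis_elem_def funpow_add funpow_swap1 divide_inverse mult.commute)
  then show ?case using Suc by (simp add: skew_norm_def)
qed

lemma inv_field_hom: "field_hom (inv_into UNIV \<sigma>)"
proof -
  have s: "\<sigma> (inv_into UNIV \<sigma> x) = x" for x using bij by (simp add: bij_is_surj surj_f_inv_f)
  have i: "inv_into UNIV \<sigma> y = x \<longleftrightarrow> y = \<sigma> x" for x y using s bij by (metis bij_inv_eq_iff)
  show ?thesis
    by unfold_locales (simp_all add: i hom_add hom_mult s)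
qed

lemma pow_inv_pow [simp]: "(\<sigma> ^^ i) ((inv_into UNIV \<sigma> ^^ i) x) = x"
proof (induction i arbitrary: x)
  case (Suc i)
  have "\<sigma> ((\<sigma> ^^ i) ((inv_into UNIV \<sigma> ^^ i) (inv_into UNIV \<sigma> x))) = x"
    using Suc bij by (simp add: bij_is_surj surj_f_inv_f)
  then show ?case by (simp add: funpow_swap1)
qed simp

lemma inv_pow_pow: "(inv_into UNIV \<sigma> ^^ i) ((\<sigma> ^^ i) x) = x"
proof (induction i arbitrary: x)
  case (Suc i)
  have "inv_into UNIV \<sigma> ((inv_into UNIV \<sigma> ^^ i) ((\<sigma> ^^ i) (\<sigma> x))) = x"
    using Suc bij by (simp add: bij_is_inj)
  then show ?case by (simp add: funpow_swap1)
qed simp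

lemma inv_pow_basis_elem:
  "(inv_into UNIV \<sigma> ^^ j) (basis_elem (i + j)) = basis_elem i"
  using inv_pow_pow[of j "basis_elem i"] by (simp add: add.commute)

text \<open>\<open>skew_shift\<close> is the matrix \<open>M\<^sub>\<rho>\<close> of the algorithm, and \<open>skew_values\<close> is \<open>M\<^sub>\<rho> N\<close> with
  column \<open>k\<close> multiplied by \<open>basis_elem k\<close>.\<close>

definition skew_shift :: "nat \<Rightarrow> (nat \<Rightarrow> 'a) \<Rightarrow> nat \<Rightarrow> nat \<Rightarrow> 'a" where
  "skew_shift m \<rho> i q = (if i \<le> q \<and> q \<le> i + m then (\<sigma> ^^ i) (\<rho> (q - i)) else 0)"

definition skew_values :: "nat \<Rightarrow> (nat \<Rightarrow> 'a) \<Rightarrow> nat \<Rightarrow> nat \<Rightarrow> 'a" where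
  "skew_values m \<rho> i k = (\<sigma> ^^ i) (\<Sum>l\<le>m. \<rho> l * basis_elem (l + k))"

text \<open>The bound on \<open>i\<close> keeps \<open>i + m\<close> below \<open>n\<close>, so the
  shifted coefficients fit into \<open>n\<close> columns.\<close>

lemma skew_values_shift:
  assumes "i < n - m"
  shows "skew_values m \<rho> i k = (\<Sum>q<n. skew_shift m \<rho> i q * basis_elem (q + k))"
proof -
  have "(\<Sum>q<n. skew_shift m \<rho> i q * basis_elem (q + k)) =
      (\<Sum>q\<in>{i..i + m}. skew_shift m \<rho> i q * basis_elem (q + k))"
    by (rule sum.mono_neutral_right) (use assms in \<open>auto simp: skew_shift_def\<close>)
  also have "\<dots> = (\<Sum>l\<le>m. skew_shift m \<rho> i (i + l) * basis_elem (i + l + k))"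
    by (rule sum.reindex_bij_witness[of _ "\<lambda>l. i + l" "\<lambda>q. q - i"]) auto
  also have "\<dots> = skew_values m \<rho> i k"
    unfolding skew_values_def pow_hom
    by (rule sum.cong) (simp_all add: skew_shift_def add.assoc)
  finally show ?thesis by simp
qed

text \<open>A relation makes the skew polynomial with coefficients \<open>c q\<close> vanish at all
  \<open>n\<close> basis elements, so these are 0 by the Moore system. Yet for the largest
  \<open>i\<close> with \<open>w i \<noteq> 0\<close> the coefficient at \<open>i + m\<close> is
  \<open>w i\<close>.\<close>

lemma skew_values_independent:
  assumes \<rho>: "\<rho> m = 1" and rel: "\<And>k. k < n \<Longrightarrow> (\<Sum>i<n - m. w i * skew_values m \<rho> i k) = 0"
  shows "\<forall>i<n - m. w i = 0"
proof (rule ccontr)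
  assume nz: "\<not> (\<forall>i<n - m. w i = 0)"
  define I where "I = {i. i < n - m \<and> w i \<noteq> 0}"
  define i where "i = Max I"
  have "finite I" "I \<noteq> {}" using nz by (auto simp: I_def)
  then have "i \<in> I" and max: "\<And>j. j \<in> I \<Longrightarrow> j \<le> i" by (simp_all add: i_def)
  then have i: "i < n - m" "w i \<noteq> 0" by (simp_all add: I_def)
  define c where "c q = (\<Sum>i<n - m. w i * skew_shift m \<rho> i q)" for q
  have "\<forall>q\<in>{..<n}. c q = 0"
  proof (rule basis_elem_moore)
    fix k assume "k < card {..<n}"
    then have k: "k < n" by simp
    have "(\<Sum>q<n. c q * basis_elem (k + q)) =
        (\<Sum>q<n. \<Sum>i<n - m. w i * (skew_shift m \<rho> i q * basis_elem (q + k)))"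
      by (simp add: c_def sum_distrib_right mult.assoc add.commute[of k])
    also have "\<dots> = (\<Sum>i<n - m. w i * skew_values m \<rho> i k)"
      by (subst sum.swap) (simp add: skew_values_shift sum_distrib_left)
    finally show "(\<Sum>q\<in>{..<n}. c q * basis_elem (k + q)) = 0" using rel[OF k] by simp
  qed simp
  then have "c (i + m) = 0" using i(1) by simp
  \<comment> \<open>Smaller shifts end before position \<open>i + m\<close>, and larger ones have
    coefficient 0.\<close>
  moreover have "c (i + m) = (\<Sum>j<n - m. if j = i then w i else 0)"
    unfolding c_def
  proof (rule sum.cong)
    fix j assume "j \<in> {..<n - m}"
    then have "w j = 0" if "i < j" using max[of j] that by (auto simp: I_def)
    then show "w j * skew_shift m \<rho> j (i + m) = (if j = i then w i else 0)"
      by (cases j i rule: linorder_cases) (simp_all add: skew_shift_def \<rho> pow_hom)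
  qed simp
  ultimately show False using i by simp
qed

end

section \<open>Recurrences and rank of the syndrome array\<close>

locale pgz_error = normal_automorphism +
  fixes e :: "nat \<Rightarrow> 'a" and t :: nat
  assumes support: "\<And>k. e k \<noteq> 0 \<Longrightarrow> k < n" and weight: "card {k. e k \<noteq> 0} \<le> t"
begin

definition K :: "nat set" where "K = {k. e k \<noteq> 0}"

definition E :: "nat \<Rightarrow> nat \<Rightarrow> 'a" where "E j k = (inv_into UNIV \<sigma> ^^ j) (e k)"

definition S :: "nat \<Rightarrow> nat \<Rightarrow> 'a" where "S i j = (\<Sum>k<n. basis_elem (i + k) * E j k)"

text \<open>This \<open>\<mu>\<close> turns out to be the rank of the syndrome matrix, see \<open>rank_SM\<close> below.\<close>

definition \<mu> :: nat where "\<mu> = (LEAST d. in_comb E d (E d))"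

lemma K_bound: "K \<subseteq> {..<n}" and K_finite: "finite K" and K_card: "card K \<le> t"
proof -
  show "K \<subseteq> {..<n}" using support by (auto simp: K_def)
  then show "finite K" using finite_subset by blast
  show "card K \<le> t" using weight by (simp add: K_def)
qed

lemma E_eq_0: "E j k = 0 \<longleftrightarrow> k \<notin> K"
  using pow_hom(4)[of j "E j k"] by (simp add: E_def K_def)

lemma E_Suc: "E (Suc j) k = inv_into UNIV \<sigma> (E j k)"
  by (simp add: E_def)

lemma hom_E_Suc: "\<sigma> (E (Suc j) k) = E j k"
  using bij by (simp add: E_Suc bij_is_surj surj_f_inv_f)

lemma pow_E: "(\<sigma> ^^ i) (E (i + j) k) = E j k"
  by (simp add: E_def funpow_add)

text \<open>\<open>\<sigma>\<close> advances the basis element by one index and undoes one inverse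
  in \<open>E\<close>; this is the recurrence between rows.\<close>

lemma S_Suc: "S (Suc i) j = \<sigma> (S i (Suc j))"
  by (simp add: S_def hom_sum hom_mult hom_E_Suc)

text \<open>All \<open>E j\<close> live on \<open>K\<close>, so the first \<open>card K + 1\<close>
  of them are dependent.\<close>

lemma exists_E_relation: "\<exists>d \<le> card K. in_comb E d (E d)"
proof -
  obtain h where h: "bij_betw h {..<card K} K"
    using ex_bij_betw_nat_finite[OF K_finite] by (auto simp: lessThan_atLeast0)
  obtain x j where x: "j < Suc (card K)" "x j \<noteq> 0"
    "\<And>i. i < card K \<Longrightarrow> (\<Sum>j<Suc (card K). E j (h i) * x j) = 0"
    by (rule underdetermined_system[of "card K" "Suc (card K)" "\<lambda>i j. E j (h i)", OF lessI], rule that)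
  have "(\<Sum>l<Suc (card K). x l * E l b) = 0" for b
  proof (cases "b \<in> K")
    case True
    then have "b \<in> h ` {..<card K}" using h by (simp add: bij_betw_imp_surj_on)
    then obtain i where "i < card K" "h i = b" by auto
    then show ?thesis using x(3)[of i] by (simp add: mult.commute)
  qed (simp add: E_eq_0[THEN iffD2])
  then obtain d where "d < Suc (card K)" "in_comb E d (E d)"
    using relation_imp_in_comb[where k = "Suc (card K)" and x = x and v = E and j = j] x(1,2) by blast
  then show ?thesis by (auto simp: less_Suc_eq_le)
qed

lemma \<mu>_in_comb: "in_comb E \<mu> (E \<mu>)"
  using exists_E_relation unfolding \<mu>_def by (metis LeastI)

lemma \<mu>_le: "\<mu> \<le> card K"
  using exists_E_relation unfolding \<mu>_def by (meson Least_le order_trans)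

lemma \<mu>_le_n: "\<mu> \<le> n"
  using \<mu>_le card_mono[OF _ K_bound] by simp

text \<open>By minimality of \<open>\<mu>\<close>, no earlier vector depends on its
  predecessors.\<close>

lemma E_independent:
  assumes "\<And>b. (\<Sum>l<\<mu>. x l * E l b) = 0"
  shows "\<forall>l<\<mu>. x l = 0"
proof (rule ccontr)
  assume "\<not> ?thesis"
  then obtain j where "j < \<mu>" "x j \<noteq> 0" by blast
  then obtain d where "d < \<mu>" "in_comb E d (E d)"
    using relation_imp_in_comb[where k = \<mu> and x = x and v = E and j = j] assms by blast
  then show False unfolding \<mu>_def by (metis not_less_Least)
qed

lemma E_in_comb: "in_comb E \<mu> (E j)"
proof (rule krylov_in_comb[where h = "inv_into UNIV \<sigma>" and \<Phi> = "\<lambda>u b. inv_into UNIV \<sigma> (u b)"])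
  interpret i: field_hom "inv_into UNIV \<sigma>" by (rule inv_field_hom)
  show "(\<lambda>b. inv_into UNIV \<sigma> (\<Sum>l<d. x l * E l b)) = (\<lambda>b. \<Sum>l<d. inv_into UNIV \<sigma> (x l) * inv_into UNIV \<sigma> (E l b))" for d x
    by (simp add: i.hom_sum i.hom_mult)
  show "E (Suc i) = (\<lambda>b. inv_into UNIV \<sigma> (E i b))" for i by (rule ext) (rule E_Suc)
qed (rule \<mu>_in_comb)

lemma sum_K: "(\<Sum>k<n. f k * E j k) = (\<Sum>k\<in>K. f k * E j k)"
  by (rule sum.mono_neutral_right) (use K_bound in \<open>auto simp: E_eq_0\<close>)

text \<open>The relation is a Moore system for the values \<open>y k\<close> on \<open>K\<close>, so
  \<open>card K\<close> rows force \<open>y = 0\<close>; then \<open>E_independent\<close>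
  applies.\<close>

lemma S_columns_independent:
  assumes "\<And>i. i < card K \<Longrightarrow> (\<Sum>j<\<mu>. x j * S i j) = 0"
  shows "\<forall>j<\<mu>. x j = 0"
proof (rule E_independent)
  define y where "y k = (\<Sum>j<\<mu>. x j * E j k)" for k
  have "\<forall>k\<in>K. y k = 0"
  proof (rule basis_elem_moore[OF K_bound])
    fix i assume i: "i < card K"
    have "(\<Sum>k\<in>K. y k * basis_elem (i + k)) = (\<Sum>k\<in>K. \<Sum>j<\<mu>. x j * (basis_elem (i + k) * E j k))"
      by (simp add: y_def sum_distrib_left mult_ac)
    also have "\<dots> = (\<Sum>j<\<mu>. x j * (\<Sum>k\<in>K. basis_elem (i + k) * E j k))"
      by (subst sum.swap) (simp add: sum_distrib_left)
    finally show "(\<Sum>k\<in>K. y k * basis_elem (i + k)) = 0"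
      using assms[OF i] by (simp add: S_def sum_K)
  qed
  moreover have "y k = 0" if "k \<notin> K" for k
    using that by (simp add: y_def E_eq_0[THEN iffD2])
  ultimately show "(\<Sum>l<\<mu>. x l * E l b) = 0" for b unfolding y_def by blast
qed

lemma S_column_in_comb: "in_comb (\<lambda>j i. S i j) \<mu> (\<lambda>i. S i j)"
proof -
  obtain x where x: "E j = (\<lambda>b. \<Sum>l<\<mu>. x l * E l b)"
    using E_in_comb unfolding in_comb_def by blast
  have "S i j = (\<Sum>l<\<mu>. x l * S i l)" for i
  proof -
    have "S i j = (\<Sum>k<n. \<Sum>l<\<mu>. x l * (basis_elem (i + k) * E l k))"
      unfolding S_def by (subst x) (simp add: sum_distrib_left mult_ac)
    also have "\<dots> = (\<Sum>l<\<mu>. x l * S i l)"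
      by (subst sum.swap) (simp add: S_def sum_distrib_left)
    finally show ?thesis .
  qed
  then show ?thesis unfolding in_comb_def by blast
qed

text \<open>Every column is a combination of the first \<open>\<mu>\<close> ones. Columns beyond the
  syndrome matrix matter too: \<open>skew_values_orthogonal\<close> uses column
  \<open>i + j\<close>.\<close>

lemma S_column_relation:
  assumes "\<And>j. j < \<mu> \<Longrightarrow> (\<Sum>i<m. x i * S i j) = 0"
  shows "(\<Sum>i<m. x i * S i j) = 0"
proof -
  obtain y where y: "\<And>i. S i j = (\<Sum>l<\<mu>. y l * S i l)"
    using S_column_in_comb[of j] unfolding in_comb_def by metis
  have "(\<Sum>i<m. x i * S i j) = (\<Sum>i<m. \<Sum>l<\<mu>. y l * (x i * S i l))"
    by (subst y) (simp add: sum_distrib_left mult_ac)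
  also have "\<dots> = (\<Sum>l<\<mu>. y l * (\<Sum>i<m. x i * S i l))"
    by (subst sum.swap) (simp add: sum_distrib_left)
  finally show ?thesis using assms by simp
qed

text \<open>A dependence among the first \<open>\<mu>\<close> rows would propagate to all rows, since each row of \<open>S\<close>
  is obtained from the previous one by a shift and \<open>\<sigma>\<close>; the rank of \<open>S\<close> would be less than
  \<open>\<mu>\<close>.\<close>

lemma S_rows_independent:
  assumes "\<And>j. j < \<mu> \<Longrightarrow> (\<Sum>i<\<mu>. x i * S i j) = 0"
  shows "\<forall>i<\<mu>. x i = 0"
proof (rule ccontr)
  assume "\<not> ?thesis"
  then obtain i0 where i0: "i0 < \<mu>" "x i0 \<noteq> 0" by blast
  obtain d where d: "d < \<mu>" "in_comb S d (S d)"
    using relation_imp_in_comb[where k = \<mu> and x = x and v = S and j = i0]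
      S_column_relation[where x = x, OF assms] i0 by blast
  have comb: "in_comb S d (S i)" for i
  proof (rule krylov_in_comb[where h = \<sigma> and \<Phi> = "\<lambda>r j. \<sigma> (r (Suc j))"])
    show "(\<lambda>j. \<sigma> (\<Sum>l<d. x l * S l (Suc j))) = (\<lambda>j. \<Sum>l<d. \<sigma> (x l) * \<sigma> (S l (Suc j)))" for d x
      by (simp add: hom_sum hom_mult)
    show "S (Suc i) = (\<lambda>j. \<sigma> (S i (Suc j)))" for i by (rule ext) (rule S_Suc)
  qed (rule d(2))
  \<comment> \<open>With fewer equations than unknowns, some nonzero \<open>y\<close> is killed by
    the first \<open>d\<close> rows, hence by all rows.\<close>
  obtain y j where y: "j < \<mu>" "y j \<noteq> 0" "\<And>i. i < d \<Longrightarrow> (\<Sum>j<\<mu>. S i j * y j) = 0"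
    by (rule underdetermined_system[of d \<mu> S, OF d(1)], rule that)
  have "(\<Sum>j<\<mu>. y j * S i j) = 0" for i
  proof -
    obtain z where z: "S i = (\<lambda>b. \<Sum>l<d. z l * S l b)"
      using comb unfolding in_comb_def by blast
    have "(\<Sum>j<\<mu>. y j * S i j) = (\<Sum>j<\<mu>. \<Sum>l<d. z l * (S l j * y j))"
      by (subst z) (simp add: sum_distrib_left mult_ac)
    also have "\<dots> = (\<Sum>l<d. z l * (\<Sum>j<\<mu>. S l j * y j))"
      by (subst sum.swap) (simp add: sum_distrib_left)
    finally show ?thesis using y(3) by simp
  qed
  then show False using S_columns_independent[of y] y(1,2) by blast
qed

section \<open>Row space of the error locator\<close>

context
  fixes \<rho> :: "nat \<Rightarrow> 'a"
  assumes monic: "\<rho> \<mu> = 1"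
    and locator: "\<And>j. j < \<mu> \<Longrightarrow> (\<Sum>i\<le>\<mu>. \<rho> i * S i j) = 0"
begin

text \<open>\<open>\<rho>\<close> annihilates column \<open>i + j\<close> of \<open>S\<close>;
  applying \<open>\<sigma> ^^ i\<close> turns \<open>E (i + j)\<close> into
  \<open>E j\<close>.\<close>

lemma skew_values_orthogonal: "(\<Sum>k<n. skew_values \<mu> \<rho> i k * E j k) = 0"
proof -
  have "(\<Sum>k<n. (\<Sum>l\<le>\<mu>. \<rho> l * basis_elem (l + k)) * E (i + j) k) =
      (\<Sum>k<n. \<Sum>l\<le>\<mu>. \<rho> l * (basis_elem (l + k) * E (i + j) k))"
    by (simp add: sum_distrib_right mult.assoc)
  also have "\<dots> = (\<Sum>l\<le>\<mu>. \<rho> l * S l (i + j))"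
    by (subst sum.swap) (simp add: S_def sum_distrib_left)
  also have "\<dots> = 0"
    using S_column_relation[of \<rho> "Suc \<mu>" "i + j"] locator by (simp add: lessThan_Suc_atMost)
  finally have "(\<sigma> ^^ i) (\<Sum>k<n. (\<Sum>l\<le>\<mu>. \<rho> l * basis_elem (l + k)) * E (i + j) k) = 0"
    by (simp add: pow_hom)
  then show ?thesis unfolding pow_hom(6) pow_hom(2) pow_E by (simp add: skew_values_def pow_hom(2,6))
qed

text \<open>The row space of the matrix of values is the annihilator of the span of the vectors \<open>E j\<close>,
  all of which have support \<open>K\<close>.\<close>

lemma unit_in_row_space:
  assumes j: "j < n"
  shows "(\<exists>w. \<forall>k<n. (\<Sum>i<n - \<mu>. w i * skew_values \<mu> \<rho> i k) = (if k = j then 1 else 0)) \<longleftrightarrow> j \<notin> K"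
proof
  assume "\<exists>w. \<forall>k<n. (\<Sum>i<n - \<mu>. w i * skew_values \<mu> \<rho> i k) = (if k = j then 1 else 0)"
  then obtain w where
    w: "\<And>k. k < n \<Longrightarrow> (\<Sum>i<n - \<mu>. w i * skew_values \<mu> \<rho> i k) = (if k = j then 1 else 0)" by blast
  \<comment> \<open>Pairing with the unit vector reads off \<open>E 0 j\<close>, while row-space
    vectors are orthogonal to \<open>E 0\<close>.\<close>
  have "E 0 j = (\<Sum>k<n. if k = j then E 0 k else 0)" using j by simp
  also have "\<dots> = (\<Sum>k<n. (\<Sum>i<n - \<mu>. w i * skew_values \<mu> \<rho> i k) * E 0 k)"
    by (rule sum.cong) (simp_all add: w)
  also have "\<dots> = (\<Sum>k<n. \<Sum>i<n - \<mu>. w i * (skew_values \<mu> \<rho> i k * E 0 k))"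
    by (simp add: sum_distrib_right mult.assoc)
  also have "\<dots> = (\<Sum>i<n - \<mu>. w i * (\<Sum>k<n. skew_values \<mu> \<rho> i k * E 0 k))"
    by (subst sum.swap) (simp add: sum_distrib_left)
  finally show "j \<notin> K" by (simp add: skew_values_orthogonal E_eq_0)
next
  assume "j \<notin> K"
  let ?v = "\<lambda>k. if k = j then 1 else 0 :: 'a"
  obtain w where "\<And>k. k < n \<Longrightarrow> ?v k = (\<Sum>i<n - \<mu>. w i * skew_values \<mu> \<rho> i k)"
  \<comment> \<open>With basis elements as \<open>C\<close>, the pairing is the leading
    \<open>\<mu>\<close> by \<open>\<mu>\<close> corner of \<open>S\<close>, whose left kernel is
    trivial.\<close>
  proof (rule annihilator_span[where B = E and C = "\<lambda>i k. basis_elem (i + k)" and v = ?v, OF \<mu>_le_n])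
    show "\<forall>i<n - \<mu>. w i = 0"
      if "\<And>k. k < n \<Longrightarrow> (\<Sum>i<n - \<mu>. w i * skew_values \<mu> \<rho> i k) = 0" for w
      by (rule skew_values_independent[where m = \<mu> and \<rho> = \<rho>, OF monic that])
    show "(\<Sum>k<n. skew_values \<mu> \<rho> i k * E l k) = 0" for i l
      by (rule skew_values_orthogonal)
    show "\<forall>i<\<mu>. x i = 0"
      if "\<And>l. l < \<mu> \<Longrightarrow> (\<Sum>i<\<mu>. x i * (\<Sum>k<n. basis_elem (i + k) * E l k)) = 0" for x
      using S_rows_independent[of x] that by (simp add: S_def)
    have "(\<Sum>k<n. ?v k * E l k) = (\<Sum>k<n. if k = j then E l k else 0)" for l
      by (rule sum.cong) simp_all
    then show "(\<Sum>k<n. ?v k * E l k) = 0" for l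
      using \<open>j \<notin> K\<close> j by (simp add: E_eq_0)
  qed blast
  then show "\<exists>w. \<forall>k<n. (\<Sum>i<n - \<mu>. w i * skew_values \<mu> \<rho> i k) = ?v k" by metis
qed

text \<open>Vanishing on \<open>Z\<close> cuts out a space of dimension \<open>n - \<mu>\<close>, hence exactly the row space, which
  then contains the unit vectors of all positions outside \<open>Z\<close>.\<close>

lemma zero_set_eq_support:
  assumes Z: "Z = {k. k < n \<and> skew_values \<mu> \<rho> 0 k = 0}" and card: "card Z = \<mu>"
  shows "Z = K"
proof (rule equalityI; rule subsetI)
  \<comment> \<open>Row \<open>i\<close> is the image of row 0 under \<open>\<sigma> ^^ i\<close>,
    so it has the same zeros.\<close>
  have zero: "skew_values \<mu> \<rho> i k = 0" if "k \<in> Z" for i k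
    using that by (simp add: Z skew_values_def pow_hom(1))
  fix j
  {
    assume jZ: "j \<in> Z"
    then have j: "j < n" by (simp add: Z)
    show "j \<in> K"
    proof (rule ccontr)
      assume "j \<notin> K"
      then obtain w where
        "\<forall>k<n. (\<Sum>i<n - \<mu>. w i * skew_values \<mu> \<rho> i k) = (if k = j then 1 else 0)"
        using unit_in_row_space[OF j] by blast
      then show False using zero[OF jZ] j by auto
    qed
  next
    assume "j \<in> K"
    then have j: "j < n" using K_bound by auto
    show "j \<in> Z"
    proof (rule ccontr)
      assume nZ: "j \<notin> Z"
      have "finite Z" by (simp add: Z)
      then obtain h where h: "bij_betw h {..<\<mu>} Z"
        using ex_bij_betw_nat_finite[of Z] card by (auto simp: lessThan_atLeast0)
      have hn: "h l < n" "h l \<in> Z" if "l < \<mu>" for l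
        using h that unfolding bij_betw_def Z by auto
      \<comment> \<open>The unit vectors at the positions in \<open>Z\<close> serve as both
        \<open>B\<close> and \<open>C\<close>; their pairing is the identity.\<close>
      let ?B = "\<lambda>l k. if k = h l then 1 else 0 :: 'a"
      let ?v = "\<lambda>k. if k = j then 1 else 0 :: 'a"
      have select: "(\<Sum>k<n. f k * ?B l k) = f (h l)" if "l < \<mu>" for f l
        using hn[OF that] by (simp add: if_distrib[of "\<lambda>c. _ * c"] cong: if_cong)
      obtain w where "\<And>k. k < n \<Longrightarrow> ?v k = (\<Sum>i<n - \<mu>. w i * skew_values \<mu> \<rho> i k)"
      proof (rule annihilator_span[where B = ?B and C = ?B and v = ?v, OF \<mu>_le_n])
        show "\<forall>i<n - \<mu>. w i = 0"
          if "\<And>k. k < n \<Longrightarrow> (\<Sum>i<n - \<mu>. w i * skew_values \<mu> \<rho> i k) = 0" for w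
          by (rule skew_values_independent[where m = \<mu> and \<rho> = \<rho>, OF monic that])
        show "(\<Sum>k<n. skew_values \<mu> \<rho> i k * ?B l k) = 0" if "l < \<mu>" for i l
          by (simp only: select[OF that] zero[OF hn(2)[OF that]])
        show "\<forall>i<\<mu>. x i = 0"
          if x: "\<And>l. l < \<mu> \<Longrightarrow> (\<Sum>i<\<mu>. x i * (\<Sum>k<n. ?B i k * ?B l k)) = 0" for x
        proof (intro allI impI)
          fix l assume l: "l < \<mu>"
          have "(\<Sum>i<\<mu>. x i * (\<Sum>k<n. ?B i k * ?B l k)) = (\<Sum>i<\<mu>. if i = l then x i else 0)"
          proof (rule sum.cong)
            fix i assume "i \<in> {..<\<mu>}"
            then have "h l = h i \<longleftrightarrow> i = l"
              using h l by (auto simp: bij_betw_def inj_on_def)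
            then show "x i * (\<Sum>k<n. ?B i k * ?B l k) = (if i = l then x i else 0)"
              by (simp only: select[OF l]) simp
          qed simp
          then show "x l = 0" using x[OF l] l by simp
        qed
        show "(\<Sum>k<n. ?v k * ?B l k) = 0" if "l < \<mu>" for l
          using hn(2)[OF that] nZ by (simp only: select[OF that]) auto
      qed blast
      then have "j \<notin> K" using unit_in_row_space[OF j] by metis
      then show False using \<open>j \<in> K\<close> by blast
    qed
  }
qed

end

section \<open>Echelon form of the syndrome matrix\<close>

text \<open>This is the matrix that the algorithm forms from the syndromes, by
  \<open>syndrome_matrix_eq\<close>.\<close>

definition SM :: "'a mat" where "SM = mat (t + 1) t (\<lambda>(i, j). S i j)"

definition locator :: "nat \<Rightarrow> 'a" where
  "locator i = (if i < \<mu> then - rcef SM $$ (\<mu>, i) else if i = \<mu> then 1 else 0)"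

lemma \<mu>_le_t: "\<mu> \<le> t"
  using \<mu>_le K_card by simp

text \<open>Since \<open>card K \<le> t\<close>, the \<open>t + 1\<close> rows suffice for
  independence of the first \<open>\<mu>\<close> columns, which span all others.\<close>

lemma rank_SM: "vec_space.rank (t + 1) SM = \<mu>"
proof (rule rank_of_leading_columns[OF _ \<mu>_le_t])
  show "\<forall>j<\<mu>. x j = 0" if x: "\<And>i. i < t + 1 \<Longrightarrow> (\<Sum>j<\<mu>. x j * SM $$ (i, j)) = 0" for x
  proof (rule S_columns_independent)
    fix i assume "i < card K"
    then have "i < t + 1" using K_card by simp
    then have "(\<Sum>j<\<mu>. x j * S i j) = (\<Sum>j<\<mu>. x j * SM $$ (i, j))"
      by (intro sum.cong) (use \<mu>_le_t in \<open>auto simp: SM_def\<close>)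
    then show "(\<Sum>j<\<mu>. x j * S i j) = 0" using x[OF \<open>i < t + 1\<close>] by simp
  qed
  show "\<exists>y. \<forall>i<t + 1. SM $$ (i, j) = (\<Sum>l<\<mu>. y l * SM $$ (i, l))" if j: "j < t" for j
  proof -
    obtain y where y: "(\<lambda>i. S i j) = (\<lambda>i. \<Sum>l<\<mu>. y l * S i l)"
      using S_column_in_comb[of j] unfolding in_comb_def by blast
    have "SM $$ (i, j) = (\<Sum>l<\<mu>. y l * SM $$ (i, l))" if "i < t + 1" for i
      using fun_cong[OF y, of i] that j \<mu>_le_t by (simp add: SM_def cong: sum.cong_simp)
    then show ?thesis by blast
  qed
qed (simp add: SM_def)

text \<open>The row space of the transpose is the column space of \<open>SM\<close>. As the leading
  \<open>\<mu>\<close> by \<open>\<mu>\<close> corner is nonsingular, the first \<open>\<mu>\<close>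
  coordinates determine a vector of this space and can be prescribed freely.\<close>

lemma rref_SM:
  shows "\<And>i k. i < t \<Longrightarrow> k < \<mu> \<Longrightarrow> rref SM\<^sup>T $$ (i, k) = (if i = k then 1 else 0)"
    and "\<And>i k. \<mu> \<le> i \<Longrightarrow> i < t \<Longrightarrow> k < t + 1 \<Longrightarrow> rref SM\<^sup>T $$ (i, k) = 0"
proof -
  have A: "SM\<^sup>T \<in> carrier_mat t (t + 1)" by (simp add: SM_def)
  have m: "\<mu> \<le> t + 1" using \<mu>_le_t by simp
  obtain W where W:
    "\<And>i j. i < \<mu> \<Longrightarrow> j < \<mu> \<Longrightarrow> (\<Sum>l<\<mu>. S i l * W l j) = (if i = j then 1 else 0)"
    "\<And>i j. i < \<mu> \<Longrightarrow> j < \<mu> \<Longrightarrow> (\<Sum>l<\<mu>. W i l * S l j) = (if i = j then 1 else 0)"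
    using nonsingular_from_left_kernel[of \<mu> S] S_rows_independent by blast
  have entry: "(\<Sum>l<t. w l * SM\<^sup>T $$ (l, k)) = (\<Sum>l<t. w l * S k l)" if "k < t + 1" for w k
    using that by (simp add: SM_def cong: sum.cong_simp)
  have inj: "\<forall>k<t + 1. (\<Sum>l<t. w l * SM\<^sup>T $$ (l, k)) = 0"
    if w: "\<And>k. k < \<mu> \<Longrightarrow> (\<Sum>l<t. w l * SM\<^sup>T $$ (l, k)) = 0" for w
  proof -
    have "in_comb (\<lambda>j i. S i j) \<mu> (\<lambda>i. \<Sum>l<t. w l * S i l)"
      by (rule in_comb_sum[where u = "\<lambda>j i. S i j"]) (rule S_column_in_comb)
    then obtain z where z: "\<And>i. (\<Sum>l<t. w l * S i l) = (\<Sum>l<\<mu>. z l * S i l)"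
      unfolding in_comb_def by metis
    \<comment> \<open>\<open>W\<close> is a left inverse of the corner and recovers \<open>z\<close>
      from the vanishing first \<open>\<mu>\<close> coordinates.\<close>
    have "z p = 0" if p: "p < \<mu>" for p
    proof -
      have "z p = (\<Sum>q<\<mu>. if p = q then z q else 0)" using p by simp
      also have "\<dots> = (\<Sum>q<\<mu>. (\<Sum>i<\<mu>. W p i * S i q) * z q)"
        by (rule sum.cong) (use p in \<open>simp_all add: W(2)\<close>)
      also have "\<dots> = (\<Sum>q<\<mu>. \<Sum>i<\<mu>. W p i * (z q * S i q))"
        by (simp add: sum_distrib_left mult_ac)
      also have "\<dots> = (\<Sum>i<\<mu>. W p i * (\<Sum>q<\<mu>. z q * S i q))"
        by (subst sum.swap) (simp add: sum_distrib_left)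
      also have "\<dots> = 0"
        by (rule sum.neutral) (use w entry m z in force)
      finally show ?thesis .
    qed
    then show ?thesis using z entry by simp
  qed
  have surj: "\<exists>w. \<forall>k<\<mu>. (\<Sum>l<t. w l * SM\<^sup>T $$ (l, k)) = (if k = i then 1 else 0)" if i: "i < \<mu>" for i
  proof (intro exI allI impI)
    fix k assume k: "k < \<mu>"
    \<comment> \<open>Column \<open>i\<close> of the inverse, padded with zeros up to length
      \<open>t\<close>.\<close>
    let ?w = "\<lambda>l. if l < \<mu> then W l i else 0"
    have "(\<Sum>l<t. ?w l * SM\<^sup>T $$ (l, k)) = (\<Sum>l<t. ?w l * S k l)"
      by (rule entry) (use k m in simp)
    also have "\<dots> = (\<Sum>l<\<mu>. ?w l * S k l)"
      by (rule sum.mono_neutral_right) (use \<mu>_le_t in auto)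
    also have "\<dots> = (\<Sum>l<\<mu>. S k l * W l i)"
      by (rule sum.cong) (simp_all add: mult.commute)
    finally show "(\<Sum>l<t. ?w l * SM\<^sup>T $$ (l, k)) = (if k = i then 1 else 0)"
      using W(1)[OF k i] by simp
  qed
  show "\<And>i k. i < t \<Longrightarrow> k < \<mu> \<Longrightarrow> rref SM\<^sup>T $$ (i, k) = (if i = k then 1 else 0)"
    by (rule rref_leading_identity(1)[OF A m inj surj])
  show "\<And>i k. \<mu> \<le> i \<Longrightarrow> i < t \<Longrightarrow> k < t + 1 \<Longrightarrow> rref SM\<^sup>T $$ (i, k) = 0"
    by (rule rref_leading_identity(2)[OF A m inj surj])
qed

lemma rcef_SM_index: "i < t + 1 \<Longrightarrow> j < t \<Longrightarrow> rcef SM $$ (i, j) = rref SM\<^sup>T $$ (j, i)"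
proof -
  have "SM\<^sup>T \<in> carrier_mat t (t + 1)" by (simp add: SM_def)
  then have "rref SM\<^sup>T \<in> carrier_mat t (t + 1)" by (rule rref_obtain)
  then show "i < t + 1 \<Longrightarrow> j < t \<Longrightarrow> rcef SM $$ (i, j) = rref SM\<^sup>T $$ (j, i)"
    by (simp add: rcef_def)
qed

lemma rcef_SM_shape: "has_rcef_shape (rcef SM) t \<mu>"
  unfolding has_rcef_shape_def using \<mu>_le_t rref_SM by (auto simp: rcef_SM_index)

text \<open>The columns of \<open>SM\<close> are combinations of those of its echelon form. Column
  \<open>l < \<mu>\<close> of the latter meets the locator in its 1 at row \<open>l\<close> and its
  entry at row \<open>\<mu>\<close>, which cancel by the choice of sign; the remaining columns are
  zero.\<close>

lemma locator_relation:
  assumes "j < \<mu>"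
  shows "(\<Sum>i\<le>\<mu>. locator i * S i j) = 0"
proof -
  have A: "SM\<^sup>T \<in> carrier_mat t (t + 1)" by (simp add: SM_def)
  have j: "j < t" using assms \<mu>_le_t by simp
  obtain V where V: "\<And>i k. i < t \<Longrightarrow> k < t + 1 \<Longrightarrow>
      SM\<^sup>T $$ (i, k) = (\<Sum>l<t. V i l * rref SM\<^sup>T $$ (l, k))"
    by (rule rref_obtain[OF A]) blast
  have "(\<Sum>i\<le>\<mu>. locator i * S i j) = (\<Sum>i\<le>\<mu>. locator i * SM\<^sup>T $$ (j, i))"
    by (rule sum.cong) (use j \<mu>_le_t in \<open>auto simp: SM_def\<close>)
  also have "\<dots> = (\<Sum>i\<le>\<mu>. \<Sum>l<t. V j l * (locator i * rref SM\<^sup>T $$ (l, i)))"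
    by (rule sum.cong) (use j \<mu>_le_t in \<open>simp_all add: V sum_distrib_left mult_ac\<close>)
  also have "\<dots> = (\<Sum>l<t. V j l * (\<Sum>i\<le>\<mu>. locator i * rref SM\<^sup>T $$ (l, i)))"
    by (subst sum.swap) (simp add: sum_distrib_left)
  also have "\<dots> = 0"
  proof (rule sum.neutral, rule ballI)
    fix l assume "l \<in> {..<t}"
    then have l: "l < t" by simp
    have "(\<Sum>i\<le>\<mu>. locator i * rref SM\<^sup>T $$ (l, i)) =
        (\<Sum>i<\<mu>. if i = l then locator i else 0) + rref SM\<^sup>T $$ (l, \<mu>)"
      unfolding lessThan_Suc_atMost[symmetric]
      by (simp add: locator_def[of \<mu>] rref_SM(1)[OF l] if_distrib[of "\<lambda>c. _ * c"] eq_commute[of l]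
        cong: if_cong sum.cong_simp)
    also have "\<dots> = 0"
      using l \<mu>_le_t rref_SM(2)[of l \<mu>] by (simp add: locator_def rcef_SM_index)
    finally show "V j l * (\<Sum>i\<le>\<mu>. locator i * rref SM\<^sup>T $$ (l, i)) = 0" by simp
  qed
  finally show ?thesis .
qed

lemma locator_\<mu>: "locator \<mu> = 1"
  by (simp add: locator_def)

section \<open>Error positions\<close>

text \<open>Both branches of the algorithm yield \<open>K\<close>. The bound \<open>t < n\<close>
  leaves room for the \<open>\<mu> + 1\<close> coefficients of the locator.\<close>

lemma error_positions_eq:
  assumes tn: "t < n"
  shows "error_positions \<sigma> n (inverse \<alpha> * \<sigma> \<alpha>) (rcef SM) \<mu> = K"
proof -
  define N where "N = norm_matrix \<sigma> n (inverse \<alpha> * \<sigma> \<alpha>)"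
  have N: "N \<in> carrier_mat n n" by (simp add: N_def norm_matrix_def)
  have N_index: "N $$ (i, j) = basis_elem (i + j) / basis_elem j" if "i < n" "j < n" for i j
    using that by (simp add: N_def norm_matrix_def skew_norm_basis_elem)
  define \<rho> where "\<rho> = rho_vec n (rcef SM) \<mu>"
  have \<rho>: "\<rho> $ i = locator i" if "i < n" for i
    using that by (simp add: \<rho>_def rho_vec_def locator_def)
  have dim: "dim_vec \<rho> = n" by (simp add: \<rho>_def rho_vec_def)
  have \<mu>n: "\<mu> < n" using \<mu>_le_t tn by simp
  define Z where "Z = zero_positions (vec_mult_mat \<rho> N)"
  \<comment> \<open>Column \<open>k\<close> of \<open>N\<close> carries the factor
    \<open>1 / basis_elem k\<close>, which does not affect zeros.\<close>
  have "vec_mult_mat \<rho> N $ k = skew_values \<mu> locator 0 k / basis_elem k" if k: "k < n" for k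
  proof -
    have "vec_mult_mat \<rho> N $ k = (\<Sum>i<n. locator i * (basis_elem (i + k) / basis_elem k))"
      using k N dim
      by (simp add: vec_mult_mat_def scalar_prod_def lessThan_atLeast0 \<rho> N_index mult.commute
        cong: sum.cong_simp)
    also have "\<dots> = (\<Sum>i\<le>\<mu>. locator i * (basis_elem (i + k) / basis_elem k))"
      by (rule sum.mono_neutral_right) (use \<mu>n in \<open>auto simp: locator_def\<close>)
    finally show ?thesis by (simp add: skew_values_def sum_divide_distrib)
  qed
  then have Z: "Z = {k. k < n \<and> skew_values \<mu> locator 0 k = 0}"
    using N by (auto simp: Z_def zero_positions_def vec_mult_mat_def)
  define P where "P = rho_matrix \<sigma> n \<mu> \<rho> * N"
  have P: "P \<in> carrier_mat (n - \<mu>) n"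
    unfolding P_def by (rule mult_carrier_mat[OF _ N]) (simp add: rho_matrix_def)
  have P_index: "P $$ (i, k) = skew_values \<mu> locator i k / basis_elem k" if "i < n - \<mu>" "k < n" for i k
  proof -
    have "P $$ (i, k) = (\<Sum>q<n. (if i \<le> q \<and> q \<le> i + \<mu> then (\<sigma> ^^ i) (\<rho> $ (q - i)) else 0) *
        (basis_elem (q + k) / basis_elem k))"
      using that N
      by (simp add: P_def rho_matrix_def scalar_prod_def lessThan_atLeast0 N_index
        cong: sum.cong_simp)
    also have "\<dots> = (\<Sum>q<n. skew_shift \<mu> locator i q * (basis_elem (q + k) / basis_elem k))"
      by (rule sum.cong) (auto simp: skew_shift_def \<rho>)
    finally have "P $$ (i, k) = \<dots>" .
    then show ?thesis using that by (simp add: skew_values_shift sum_divide_distrib)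
  qed
  \<comment> \<open>The same column factors change a unit vector at \<open>j\<close> only by the
    scalar \<open>basis_elem j\<close>, which is absorbed into \<open>w\<close>.\<close>
  have row_space: "(\<exists>w. \<forall>k<n. (\<Sum>l<n - \<mu>. w l * P $$ (l, k)) = (if k = j then 1 else 0)) \<longleftrightarrow> j \<notin> K"
    if j: "j < n" for j
  proof -
    have P_sum: "(\<Sum>l<n - \<mu>. w l * P $$ (l, k)) =
        (\<Sum>l<n - \<mu>. w l * skew_values \<mu> locator l k) / basis_elem k" if "k < n" for w k
      using that by (simp add: P_index sum_divide_distrib)
    have "(\<exists>w. \<forall>k<n. (\<Sum>l<n - \<mu>. w l * P $$ (l, k)) = (if k = j then 1 else 0)) \<longleftrightarrow>
        (\<exists>w. \<forall>k<n. (\<Sum>l<n - \<mu>. w l * skew_values \<mu> locator l k) = (if k = j then 1 else 0))"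
    proof
      assume "\<exists>w. \<forall>k<n. (\<Sum>l<n - \<mu>. w l * P $$ (l, k)) = (if k = j then 1 else 0)"
      then obtain w where w: "\<And>k. k < n \<Longrightarrow>
          (\<Sum>l<n - \<mu>. w l * P $$ (l, k)) = (if k = j then 1 else 0)" by blast
      have "(\<Sum>l<n - \<mu>. w l / basis_elem j * skew_values \<mu> locator l k) = (if k = j then 1 else 0)"
        if "k < n" for k
      proof -
        have "(\<Sum>l<n - \<mu>. w l / basis_elem j * skew_values \<mu> locator l k) =
            (\<Sum>l<n - \<mu>. w l * skew_values \<mu> locator l k) / basis_elem j"
          by (simp add: sum_divide_distrib)
        then show ?thesis using w[OF that] P_sum[OF that, of w] by (auto split: if_splits)
      qed
      then show "\<exists>w. \<forall>k<n. (\<Sum>l<n - \<mu>. w l * skew_values \<mu> locator l k) = (if k = j then 1 else 0)"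
        by (intro exI[of _ "\<lambda>l. w l / basis_elem j"]) blast
    next
      assume "\<exists>w. \<forall>k<n. (\<Sum>l<n - \<mu>. w l * skew_values \<mu> locator l k) = (if k = j then 1 else 0)"
      then obtain w where w: "\<And>k. k < n \<Longrightarrow>
          (\<Sum>l<n - \<mu>. w l * skew_values \<mu> locator l k) = (if k = j then 1 else 0)" by blast
      have "(\<Sum>l<n - \<mu>. w l * basis_elem j * P $$ (l, k)) = (if k = j then 1 else 0)"
        if "k < n" for k
      proof -
        have "(\<Sum>l<n - \<mu>. w l * basis_elem j * P $$ (l, k)) =
            (\<Sum>l<n - \<mu>. w l * P $$ (l, k)) * basis_elem j"
          by (simp add: sum_distrib_left sum_distrib_right mult_ac)
        then show ?thesis using w[OF that] P_sum[OF that, of w] by auto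
      qed
      then show "\<exists>w. \<forall>k<n. (\<Sum>l<n - \<mu>. w l * P $$ (l, k)) = (if k = j then 1 else 0)"
        by (intro exI[of _ "\<lambda>l. w l * basis_elem j"]) blast
    qed
    also have "\<dots> \<longleftrightarrow> j \<notin> K"
      by (rule unit_in_row_space[where \<rho> = locator, OF locator_\<mu> locator_relation j])
    finally show ?thesis .
  qed
  have "rref P \<in> carrier_mat (n - \<mu>) n" using P by (rule rref_obtain)
  then have "zero_columns (keep_unit_rows (rref P)) =
      {j. j < n \<and> \<not> (\<exists>i<n - \<mu>. row (rref P) i = unit_vec n j)}"
    by (rule zero_columns_keep_unit_rows)
  also have "\<dots> = {j. j < n \<and> j \<in> K}"
    by (rule Collect_cong, rule conj_cong[OF refl])
      (simp only: rref_unit_row[OF P] row_space not_not)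
  also have "\<dots> = K" using K_bound by auto
  finally have "zero_columns (keep_unit_rows (rref P)) = K" .
  moreover have "Z = K" if "\<mu> = card Z"
    by (rule zero_set_eq_support[where \<rho> = locator, OF locator_\<mu> locator_relation Z that[symmetric]])
  ultimately show ?thesis
    unfolding error_positions_def Let_def N_def[symmetric] \<rho>_def[symmetric] P_def[symmetric]
      Z_def[symmetric] by presburger
qed

section \<open>Error values\<close>

lemma place_values_eq:
  defines "ks \<equiv> sorted_list_of_set K"
  shows "place_values n ks (vec (card K) (\<lambda>j. e (ks ! j))) = vec n e"
proof (rule eq_vecI)
  have len: "length ks = card K" and ks: "set ks = K" "distinct ks"
    using K_finite by (simp_all add: ks_def)
  fix k assume "k < dim_vec (vec n e)"
  then have k: "k < n" by simp
  have "(\<Sum>j | j < card K \<and> ks ! j = k. e (ks ! j)) = e k"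
  proof (cases "k \<in> K")
    case True
    then obtain j where j: "j < card K" "ks ! j = k"
      using ks(1) len by (metis in_set_conv_nth)
    then have "{j. j < card K \<and> ks ! j = k} = {j}"
      using ks(2) len by (auto simp: nth_eq_iff_index_eq)
    then show ?thesis using j by simp
  next
    case False
    then have "{j. j < card K \<and> ks ! j = k} = {}" using ks(1) len by (metis (mono_tags, lifting) empty_Collect_eq nth_mem)
    then show ?thesis using False by (simp add: K_def)
  qed
  then show "place_values n ks (vec (card K) (\<lambda>j. e (ks ! j))) $ k = vec n e $ k"
    using k by (simp add: place_values_def len)
qed (simp add: place_values_def)

context
  fixes s :: "nat \<Rightarrow> 'a"
  assumes s: "\<And>i. i < 2 * t \<Longrightarrow> s i = (\<Sum>k<n. e k * basis_elem (i + k)) / basis_elem i"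
begin

text \<open>The denominator of \<open>s (i + j)\<close> becomes \<open>basis_elem i\<close> under
  the inverse power and cancels against \<open>(\<sigma> ^^ i) \<alpha>\<close>. The largest index
  is \<open>i + j = 2 * t - 1\<close>, still covered by \<open>s\<close>.\<close>

lemma syndrome_matrix_eq: "syndrome_matrix \<sigma> \<alpha> t s = SM"
proof (rule eq_matI)
  fix i j assume "i < dim_row SM" "j < dim_col SM"
  then have ij: "i < t + 1" "j < t" by (simp_all add: SM_def)
  interpret p: field_hom "inv_into UNIV \<sigma> ^^ j"
    by (rule funpow_field_hom[OF inv_field_hom])
  have "(inv_into UNIV \<sigma> ^^ j) (s (i + j)) =
      (\<Sum>k<n. E j k * (inv_into UNIV \<sigma> ^^ j) (basis_elem (i + k + j))) /
        (inv_into UNIV \<sigma> ^^ j) (basis_elem (i + j))"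
    using ij by (simp add: s divide_inverse p.hom_mult p.hom_sum p.hom_inverse E_def ac_simps)
  also have "\<dots> = (\<Sum>k<n. E j k * basis_elem (i + k)) / basis_elem i"
    by (simp only: inv_pow_basis_elem)
  finally show "syndrome_matrix \<sigma> \<alpha> t s $$ (i, j) = SM $$ (i, j)"
    using ij by (simp add: syndrome_matrix_def SM_def S_def mult.commute flip: basis_elem_def)
qed (simp_all add: syndrome_matrix_def SM_def)

text \<open>Vanishing syndromes give Moore equations for \<open>e\<close> on \<open>K\<close>, and
  \<open>card K \<le> 2 * t\<close> of them suffice.\<close>

lemma all_syndromes_zero:
  assumes "\<forall>i<2 * t. s i = 0"
  shows "K = {}"
proof -
  have "\<forall>k\<in>K. e k = 0"
  proof (rule basis_elem_moore[OF K_bound])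
    fix i assume "i < card K"
    then have "i < 2 * t" using K_card by simp
    then have "(\<Sum>k<n. e k * basis_elem (i + k)) = 0" using s[of i] assms by simp
    also have "(\<Sum>k<n. e k * basis_elem (i + k)) = (\<Sum>k\<in>K. e k * basis_elem (i + k))"
      by (rule sum.mono_neutral_right) (use K_bound in \<open>auto simp: K_def\<close>)
    finally show "(\<Sum>k\<in>K. e k * basis_elem (i + k)) = 0" .
  qed
  then show ?thesis by (auto simp: K_def)
qed

text \<open>The difference of a solution and the true error values solves a homogeneous Moore system
  on \<open>K\<close>.\<close>

lemma solves_value_system_iff:
  defines "ks \<equiv> sorted_list_of_set K"
  shows "solves_value_system \<sigma> \<alpha> s ks x \<longleftrightarrow> x = vec (card K) (\<lambda>j. e (ks ! j))"
proof -
  have len: "length ks = card K" and ks: "set ks = K" "distinct ks"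
    using K_finite by (simp_all add: ks_def)
  have bij: "bij_betw ((!) ks) {..<card K} K"
    by (rule bij_betw_nth) (simp_all add: ks len)
  have reindex: "(\<Sum>j<card K. f (ks ! j)) = (\<Sum>k\<in>K. f k)" for f :: "nat \<Rightarrow> 'a"
    using sum.reindex_bij_betw[OF bij] .
  have rhs: "(\<sigma> ^^ i) \<alpha> * s i = (\<Sum>j<card K. e (ks ! j) * basis_elem (i + ks ! j))" if "i < card K" for i
  proof -
    have "i < 2 * t" using that K_card by simp
    then have "(\<sigma> ^^ i) \<alpha> * s i = (\<Sum>k<n. e k * basis_elem (i + k))"
      using s[of i] by (simp flip: basis_elem_def)
    also have "\<dots> = (\<Sum>k\<in>K. e k * basis_elem (i + k))"
      by (rule sum.mono_neutral_right) (use K_bound in \<open>auto simp: K_def\<close>)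
    also have "\<dots> = (\<Sum>j<card K. e (ks ! j) * basis_elem (i + ks ! j))"
      by (rule reindex[symmetric])
    finally show ?thesis .
  qed
  have lhs: "vec_mult_mat x (mat (card K) (card K) (\<lambda>(j, i). (\<sigma> ^^ (ks ! j + i)) \<alpha>)) $ i =
      (\<Sum>j<card K. x $ j * basis_elem (i + ks ! j))" if "x \<in> carrier_vec (card K)" "i < card K" for i
    using that
    by (simp add: vec_mult_mat_def scalar_prod_def lessThan_atLeast0 mult.commute add.commute
      flip: basis_elem_def cong: sum.cong_simp)
  have iff: "solves_value_system \<sigma> \<alpha> s ks x \<longleftrightarrow> x \<in> carrier_vec (card K) \<and>
      (\<forall>i<card K. (\<Sum>j<card K. x $ j * basis_elem (i + ks ! j)) =
        (\<Sum>j<card K. e (ks ! j) * basis_elem (i + ks ! j)))"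
    unfolding solves_value_system_def Let_def len
    by (rule conj_cong[OF refl], subst vec_eq_iff) (simp add: lhs rhs, simp add: vec_mult_mat_def)
  show ?thesis
  proof
    assume "solves_value_system \<sigma> \<alpha> s ks x"
    then have x: "x \<in> carrier_vec (card K)" and eq: "\<And>i. i < card K \<Longrightarrow>
      (\<Sum>j<card K. (x $ j - e (ks ! j)) * basis_elem (i + ks ! j)) = 0"
      unfolding iff by (simp_all add: left_diff_distrib sum_subtractf)
    \<comment> \<open>The difference is carried over from list positions to elements of
      \<open>K\<close>.\<close>
    define c where "c k = x $ (inv_into {..<card K} ((!) ks) k) - e k" for k
    have c: "c (ks ! j) = x $ j - e (ks ! j)" if "j < card K" for j
      using that bij by (simp add: c_def inv_into_f_f bij_betw_def)
    have "\<forall>k\<in>K. c k = 0"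
    proof (rule basis_elem_moore[OF K_bound])
      fix i assume "i < card K"
      then show "(\<Sum>k\<in>K. c k * basis_elem (i + k)) = 0"
        using eq reindex[of "\<lambda>k. c k * basis_elem (i + k)"] by (simp add: c cong: sum.cong_simp)
    qed
    then have "x $ j = e (ks ! j)" if "j < card K" for j
      using \<open>\<forall>k\<in>K. c k = 0\<close> c[OF that] that ks(1) len by (metis eq_iff_diff_eq_0 nth_mem)
    then show "x = vec (card K) (\<lambda>j. e (ks ! j))" using x by auto
  next
    assume "x = vec (card K) (\<lambda>j. e (ks ! j))"
    then show "solves_value_system \<sigma> \<alpha> s ks x" unfolding iff by simp
  qed
qed

end

section \<open>Correctness of decoding\<close>

lemma pgz_correct:
  assumes tn: "t < n"
    and s: "\<And>i. i < 2 * t \<Longrightarrow> syndrome \<sigma> n (inverse \<alpha> * \<sigma> \<alpha>) y i =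
      (\<Sum>k<n. e k * basis_elem (i + k)) / basis_elem i"
  shows "pgz \<sigma> n \<alpha> t y = Some (vec n e)"
proof (cases "\<forall>i<2 * t. syndrome \<sigma> n (inverse \<alpha> * \<sigma> \<alpha>) y i = 0")
  let ?s = "syndrome \<sigma> n (inverse \<alpha> * \<sigma> \<alpha>) y"
  case True
  then have "K = {}" by (intro all_syndromes_zero[where s = ?s] s)
  then have "vec n e = 0\<^sub>v n" by (auto simp: K_def)
  then show ?thesis using True by (simp add: pgz_def)
next
  let ?s = "syndrome \<sigma> n (inverse \<alpha> * \<sigma> \<alpha>) y"
  case False
  have "syndrome_matrix \<sigma> \<alpha> t ?s = SM"
    by (rule syndrome_matrix_eq) (rule s)
  moreover have "solves_value_system \<sigma> \<alpha> ?s (sorted_list_of_set K) =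
      (\<lambda>x. x = vec (card K) (\<lambda>j. e (sorted_list_of_set K ! j)))"
    by (rule ext, rule solves_value_system_iff) (rule s)
  ultimately show ?thesis
    unfolding pgz_def Let_def using False
    by (simp only: rank_SM error_positions_eq[OF tn] rcef_SM_shape)
      (simp add: place_values_eq)
qed

end

theorem theorem4p8:
  fixes \<sigma> :: "'a::field \<Rightarrow> 'a" and \<alpha> \<beta> :: 'a and n \<delta> t :: nat
    and g :: "'a poly" and C :: "'a vec set" and c e :: "'a vec"
  assumes aut: "field_hom \<sigma>" "bij \<sigma>"
    and order: "has_finite_order \<sigma> n"
    and normal: "normal_basis \<sigma> n \<alpha>"
    and beta: "\<beta> = inverse \<alpha> * \<sigma> \<alpha>"
    and delta: "2 \<le> \<delta>" "\<delta> \<le> n"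
    and g: "is_lclm \<sigma> {[:- (\<sigma> ^^ i) \<beta>, 1:] | i. i \<le> \<delta> - 2} g"
    and code: "C \<subseteq> carrier_vec n"
      "vec_to_class \<sigma> n ` C =
         left_principal_ideal (skew_quotient_ring \<sigma> n) (residue_class \<sigma> n g)"
    and t: "t = (\<delta> - 1) div 2"
    and c: "c \<in> C"
    and e: "e \<in> carrier_vec n" "hamming_weight e \<le> t"
  shows "pgz \<sigma> n \<alpha> t (c + e) = Some e"
proof -
  \<comment> \<open>Padding \<open>e\<close> with zeros from \<open>n\<close> on gives a total
    function, as \<open>pgz_error\<close> expects.\<close>
  define \<epsilon> where "\<epsilon> k = (if k < n then e $ k else 0)" for k
  interpret field_hom \<sigma> by fact
  have ord: "\<sigma> ^^ n = id" "0 < n" using order by (simp_all add: has_finite_order_def)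
  have "{k. \<epsilon> k \<noteq> 0} = {i. i < dim_vec e \<and> e $ i \<noteq> 0}"
    using e(1) by (auto simp: \<epsilon>_def)
  then interpret pgz_error \<sigma> n \<alpha> \<epsilon> t
    using aut ord normal e(2)
    by unfold_locales (auto simp: hamming_weight_def \<epsilon>_def split: if_splits)
  have "syndrome \<sigma> n (inverse \<alpha> * \<sigma> \<alpha>) (c + e) i =
      (\<Sum>k<n. \<epsilon> k * basis_elem (i + k)) / basis_elem i" if i: "i < 2 * t" for i
  proof -
    \<comment> \<open>The basis element is a root of \<open>x - (\<sigma> ^^ i) \<beta>\<close>, and
      \<open>i < 2 * t \<le> \<delta> - 1\<close> puts this among the polynomials whose common
      multiple is \<open>g\<close>.\<close>
    have "skew_eval \<sigma> g (basis_elem i) = 0"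
    proof (rule lclm_skew_eval[OF aut(1) g])
      show "[:- (\<sigma> ^^ i) \<beta>, 1:] \<in> {[:- (\<sigma> ^^ i) \<beta>, 1:] | i. i \<le> \<delta> - 2}"
        using i t by auto
      show "\<sigma> (basis_elem i) = (\<sigma> ^^ i) \<beta> * basis_elem i"
        using skew_norm_basis_elem[of 1 i] by (simp add: beta skew_norm_def)
    qed
    moreover have "vec_to_class \<sigma> n c \<in>
        left_principal_ideal (skew_quotient_ring \<sigma> n) (residue_class \<sigma> n g)"
      using code(2) c by blast
    ultimately have "(\<Sum>j<n. c $ j * (\<sigma> ^^ j) (basis_elem i)) = 0"
      using codeword_skew_eval[OF aut(1) ord] by blast
    \<comment> \<open>Division by \<open>basis_elem i\<close> turns operator evaluation into the
      norms of the syndrome.\<close>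
    then have "(\<Sum>j<n. c $ j * (basis_elem (j + i) / basis_elem i)) = 0"
      by (simp flip: sum_divide_distrib)
    moreover have "(c + e) $ j = c $ j + \<epsilon> j" if "j < n" for j
      using that e(1) by (simp add: \<epsilon>_def)
    ultimately show ?thesis
      by (simp add: syndrome_def skew_norm_basis_elem distrib_right add_divide_distrib sum.distrib
        sum_divide_distrib add.commute[of i] cong: sum.cong_simp)
  qed
  moreover have "t < n" using t delta by auto
  ultimately have "pgz \<sigma> n \<alpha> t (c + e) = Some (vec n \<epsilon>)" by (intro pgz_correct)
  moreover have "vec n \<epsilon> = e" using e(1) by (auto simp: \<epsilon>_def)
  ultimately show ?thesis by simp
qed

end
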